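(* The function $\overline{V}(x,c)=\lim_{n\to\infty}V^n(x,c)$ coincides with the optimal value function $V(x,c)$ for all $(x,c)\in[0,\infty)\times[0,\overline{c}]$.
   Context: Cramér–Lundberg model: the uncontrolled surplus is $X_t=x+pt-\sum_{i=1}^{N_t}U_i$, where $x\ge0$ is the initial surplus, $p>0$ the premium rate, $N_t$ a Poisson process with intensity $\beta>0$, and the claims $U_i$ are i.i.d. positive random variables, independent of $N$, with continuous distribution function $F$; $p>\beta\mathbb{E}[U_1]$. Standing assumption (A1): $F$ is globally Lipschitz with constant $K>0$. Let $(\mathcal{F}_t)$ be the completed filtration generated by $X$. Fix $\overline{c}>0$ and $q>0$. $\Pi_{x,c,\overline{c}}$ is the set of càdlàg, adapted, non-decreasing processes $C$ with $c\le C_t\le\overline{c}$; $X^C_t=X_t-\int_0^tC_sds$ ($X_0=x$), $\tau=\inf\{t\ge0:X^C_t<0\}$, $J(x;C)=\mathbb{E}[\int_0^\tau e^{-qs}C_sds]$, $V(x,c)=\sup_{C\in\Pi_{x,c,\overline{c}}}J(x;C)$. Convention: only strategies are considered such that if $C_{t^-}=p$ and $X^C_t=0$ for some $t>0$ then $C_s=p$ for $s\ge t$ until ruin; the only strategy in $\Pi_{0,p,\overline{c}}$ is to pay at rate $p$ until the first claim. For a finite set $\mathcal{G}\subset[0,\overline{c}]$ containing $\overline{c}$, $\Pi^{\mathcal{G}}_{x,c,\overline{c}}=\{C\in\Pi_{x,c,\overline{c}}:C_t\in\mathcal{G}\ \forall t\}$ and $V^{\mathcal{G}}(x,c)=\sup_{C\in\Pi^{\mathcal{G}}_{x,c,\overline{c}}}J(x;C)$.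 For $n\in\mathbb{N}$, $\mathcal{G}^n=\{k\overline{c}/2^n:k=0,\dots,2^n\}$, with the point $p$ added when $\overline{c}>p$; $V^n:=V^{\mathcal{G}^n}$ (non-decreasing in $n$). *)

theory Defs
  imports "HOL-Probability.Probability"
begin

text \<open>Cramer-Lundberg model built from i.i.d. exponential inter-arrival times T i
 (so that N is a Poisson process of intensity beta) and i.i.d. claims U i.\<close>

definition arrival :: "(nat \<Rightarrow> 'a \<Rightarrow> real) \<Rightarrow> nat \<Rightarrow> 'a \<Rightarrow> real" where
  "arrival T i \<omega> = (\<Sum>j\<le>i. T j \<omega>)"

definition surplus ::
  "real \<Rightarrow> (nat \<Rightarrow> 'a \<Rightarrow> real) \<Rightarrow> (nat \<Rightarrow> 'a \<Rightarrow> real) \<Rightarrow> real \<Rightarrow> real \<Rightarrow> 'a \<Rightarrow> real" where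
  "surplus p T U x t \<omega> = x + p * t - (\<Sum>i\<in>{i. arrival T i \<omega> \<le> t}. U i \<omega>)"

text \<open>Completed filtration generated by X (independent of the initial surplus x).\<close>
definition filt ::
  "'a measure \<Rightarrow> real \<Rightarrow> (nat \<Rightarrow> 'a \<Rightarrow> real) \<Rightarrow> (nat \<Rightarrow> 'a \<Rightarrow> real) \<Rightarrow> real \<Rightarrow> 'a measure" where
  "filt M p T U t = sigma (space M)
     ({surplus p T U 0 s -` B \<inter> space M | s B. 0 \<le> s \<and> s \<le> t \<and> B \<in> sets borel}
      \<union> null_sets (completion M))"

definition ctrl_surplus ::
  "real \<Rightarrow> (nat \<Rightarrow> 'a \<Rightarrow> real) \<Rightarrow> (nat \<Rightarrow> 'a \<Rightarrow> real) \<Rightarrow> real \<Rightarrow> (real \<Rightarrow> 'a \<Rightarrow> real)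
     \<Rightarrow> real \<Rightarrow> 'a \<Rightarrow> real" where
  "ctrl_surplus p T U x C t \<omega> = surplus p T U x t \<omega> - integral {0..t} (\<lambda>s. C s \<omega>)"

definition ruin_time ::
  "real \<Rightarrow> (nat \<Rightarrow> 'a \<Rightarrow> real) \<Rightarrow> (nat \<Rightarrow> 'a \<Rightarrow> real) \<Rightarrow> real \<Rightarrow> (real \<Rightarrow> 'a \<Rightarrow> real)
     \<Rightarrow> 'a \<Rightarrow> ereal" where
  "ruin_time p T U x C \<omega> = Inf {ereal t | t. 0 \<le> t \<and> ctrl_surplus p T U x C t \<omega> < 0}"

text \<open>The admissible set Pi_{x,c,cbar}, including the convention concerning the rate p
  (at time 0 the left value C_{0-} is taken to be c; this encodes that the only strategy
  in Pi_{0,p,cbar} pays at rate p until ruin, i.e. until the first claim).\<close>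
definition admissible ::
  "'a measure \<Rightarrow> real \<Rightarrow> (nat \<Rightarrow> 'a \<Rightarrow> real) \<Rightarrow> (nat \<Rightarrow> 'a \<Rightarrow> real) \<Rightarrow> real \<Rightarrow> real \<Rightarrow> real
     \<Rightarrow> (real \<Rightarrow> 'a \<Rightarrow> real) set" where
  "admissible M p T U cbar x c = {C.
     (\<forall>t\<ge>0. C t \<in> borel_measurable (filt M p T U t)) \<and>
     (\<forall>\<omega>\<in>space M.
        mono_on {0..} (\<lambda>s. C s \<omega>) \<and>
        (\<forall>t\<ge>0. c \<le> C t \<omega> \<and> C t \<omega> \<le> cbar) \<and>
        (\<forall>t\<ge>0. continuous (at_right t) (\<lambda>s. C s \<omega>)) \<and>
        (\<forall>t>0. \<exists>l. ((\<lambda>s. C s \<omega>) \<longlongrightarrow> l) (at_left t)) \<and>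
        (\<forall>t\<ge>0. ((t > 0 \<and> Lim (at_left t) (\<lambda>s. C s \<omega>) = p) \<or> (t = 0 \<and> c = p)) \<and>
                 ctrl_surplus p T U x C t \<omega> = 0 \<longrightarrow>
                 (\<forall>s\<ge>t. ereal s < ruin_time p T U x C \<omega> \<longrightarrow> C s \<omega> = p)))}"

definition Jval ::
  "'a measure \<Rightarrow> real \<Rightarrow> (nat \<Rightarrow> 'a \<Rightarrow> real) \<Rightarrow> (nat \<Rightarrow> 'a \<Rightarrow> real) \<Rightarrow> real \<Rightarrow> real
     \<Rightarrow> (real \<Rightarrow> 'a \<Rightarrow> real) \<Rightarrow> real" where
  "Jval M p T U q x C = enn2real (\<integral>\<^sup>+ \<omega>. (\<integral>\<^sup>+ s.
      ennreal (indicator {s. 0 \<le> s \<and> ereal s < ruin_time p T U x C \<omega>} s * exp (- q * s) * C s \<omega>)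
      \<partial>lborel) \<partial>completion M)"

definition Vopt ::
  "'a measure \<Rightarrow> real \<Rightarrow> (nat \<Rightarrow> 'a \<Rightarrow> real) \<Rightarrow> (nat \<Rightarrow> 'a \<Rightarrow> real) \<Rightarrow> real \<Rightarrow> real \<Rightarrow> real
     \<Rightarrow> real \<Rightarrow> real" where
  "Vopt M p T U q cbar x c = (SUP C \<in> admissible M p T U cbar x c. Jval M p T U q x C)"

definition VG ::
  "'a measure \<Rightarrow> real \<Rightarrow> (nat \<Rightarrow> 'a \<Rightarrow> real) \<Rightarrow> (nat \<Rightarrow> 'a \<Rightarrow> real) \<Rightarrow> real \<Rightarrow> real \<Rightarrow> real set
     \<Rightarrow> real \<Rightarrow> real \<Rightarrow> real" where
  "VG M p T U q cbar G x c = (SUP C \<in> {C \<in> admissible M p T U cbar x c.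
       \<forall>t\<ge>0. \<forall>\<omega>\<in>space M. C t \<omega> \<in> G}. Jval M p T U q x C)"

definition grid :: "real \<Rightarrow> real \<Rightarrow> nat \<Rightarrow> real set" where
  "grid p cbar n = {real k * cbar / 2 ^ n | k. k \<le> 2 ^ n} \<union> (if cbar > p then {p} else {})"

definition Vn ::
  "'a measure \<Rightarrow> real \<Rightarrow> (nat \<Rightarrow> 'a \<Rightarrow> real) \<Rightarrow> (nat \<Rightarrow> 'a \<Rightarrow> real) \<Rightarrow> real \<Rightarrow> real \<Rightarrow> nat
     \<Rightarrow> real \<Rightarrow> real \<Rightarrow> real" where
  "Vn M p T U q cbar n x c = VG M p T U q cbar (grid p cbar n) x c"

end

theory Submission
  imports Defs
begin

text \<open>
  An admissible rate process \<open>C\<close> is rounded down to the grid, except that it starts from the smallest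
  grid point above \<open>c\<close>. The rounded rate exceeds \<open>C\<close> by at most the mesh, and it does not exceed \<open>p\<close>
  where \<open>C\<close> does not, because \<open>p\<close> is a grid point whenever it matters. Between two claims the
  controlled surplus increases as long as the rate is at most \<open>p\<close> and decreases afterwards, so the
  rounded strategy survives up to a time before the ruin of \<open>C\<close> as soon as it survives the finitely
  many claims before that time. For a fine mesh this holds if the surplus under \<open>C\<close> never jumps exactly to zero. The
  latter is almost sure: just before the claim \<open>U i\<close> the surplus is measurable with respect to the
  other variables, hence independent of \<open>U i\<close>, whose distribution has no atoms. Thus the ruin times
  of the rounded strategies are asymptotically at least that of \<open>C\<close>, and Fatou's lemma gives
  \<open>J(C) \<le> liminf J(C\<^sup>n)\<close>.
\<close>

section \<open>Regular paths of the controlled surplus\<close>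

text \<open>The almost sure properties on which the pathwise arguments rest. The last conjunct
  excludes explosion; without it the sum in \<open>surplus\<close> could range over an infinite set
  and default to 0.\<close>

definition regular_path :: "(nat \<Rightarrow> 'a \<Rightarrow> real) \<Rightarrow> (nat \<Rightarrow> 'a \<Rightarrow> real) \<Rightarrow> 'a \<Rightarrow> bool" where
  "regular_path T U \<omega> \<longleftrightarrow> (\<forall>i. 0 < T i \<omega>) \<and> (\<forall>i. 0 < U i \<omega>) \<and> (\<forall>t. \<exists>i. t < arrival T i \<omega>)"

lemma arrival_strict_mono:
  assumes "regular_path T U \<omega>"
  shows "strict_mono (\<lambda>i. arrival T i \<omega>)"
  using assms by (auto simp: strict_mono_Suc_iff arrival_def regular_path_def)

lemma arrival_pos:
  assumes "regular_path T U \<omega>"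
  shows "0 < arrival T i \<omega>"
  using assms by (auto simp: arrival_def regular_path_def intro!: sum_pos)

lemma arrivals_before_subset:
  assumes "regular_path T U \<omega>" and "t < arrival T i \<omega>"
  shows "{j. arrival T j \<omega> \<le> t} \<subseteq> {..<i}"
proof
  fix j assume "j \<in> {j. arrival T j \<omega> \<le> t}"
  then have "arrival T j \<omega> < arrival T i \<omega>" using assms(2) by simp
  then show "j \<in> {..<i}"
    using strict_mono_less[OF arrival_strict_mono[OF assms(1)]] by simp
qed

lemma finite_arrivals_before:
  assumes "regular_path T U \<omega>"
  shows "finite {j. arrival T j \<omega> \<le> t}"
proof -
  obtain i where "t < arrival T i \<omega>" using assms unfolding regular_path_def by blast
  from arrivals_before_subset[OF assms this] show ?thesis
    by (rule finite_subset) simp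
qed

lemma mono_rate_integrable:
  fixes f :: "real \<Rightarrow> real"
  assumes "mono_on {0..} f" and "0 \<le> a"
  shows "f integrable_on {a..b}"
  by (rule integrable_on_mono_on, rule mono_on_subset[OF assms(1)]) (use assms(2) in auto)

lemma rate_integral_split:
  fixes f :: "real \<Rightarrow> real"
  assumes "mono_on {0..} f" and "0 \<le> a" and "a \<le> b"
  shows "integral {0..b} f = integral {0..a} f + integral {a..b} f"
  using Henstock_Kurzweil_Integration.integral_combine[OF assms(2,3) mono_rate_integrable[OF assms(1), of 0 b]]
  by simp

text \<open>Claims after \<open>a\<close> only lower the surplus, and by monotonicity the rate is at
  least \<open>m\<close> from \<open>a\<close> on. A value \<open>m\<close> above \<open>p\<close>
  yields strict decrease, \<open>m = 0\<close> the general growth bound.\<close>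

lemma ctrl_surplus_le:
  assumes reg: "regular_path T U \<omega>" and C: "mono_on {0..} (\<lambda>s. C s \<omega>)"
    and "0 \<le> a" "a \<le> b" and m: "m \<le> C a \<omega>"
  shows "ctrl_surplus p T U x C b \<omega> \<le> ctrl_surplus p T U x C a \<omega> + (p - m) * (b - a)"
proof -
  have "integral {a..b} (\<lambda>s. m) \<le> integral {a..b} (\<lambda>s. C s \<omega>)"
  proof (rule integral_le)
    show "(\<lambda>s. C s \<omega>) integrable_on {a..b}" by (rule mono_rate_integrable) fact+
    fix s assume "s \<in> {a..b}"
    with m mono_onD[OF C, of a s] assms(3) show "m \<le> C s \<omega>" by auto
  qed auto
  then have "m * (b - a) \<le> integral {a..b} (\<lambda>s. C s \<omega>)"
    using \<open>a \<le> b\<close> by (simp add: algebra_simps)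
  moreover have "(\<Sum>i\<in>{i. arrival T i \<omega> \<le> a}. U i \<omega>) \<le> (\<Sum>i\<in>{i. arrival T i \<omega> \<le> b}. U i \<omega>)"
    using finite_arrivals_before[OF reg] reg \<open>a \<le> b\<close>
    by (intro sum_mono2) (auto simp: regular_path_def less_imp_le)
  ultimately show ?thesis
    unfolding ctrl_surplus_def surplus_def rate_integral_split[OF C assms(3,4)]
    by (simp add: algebra_simps)
qed

text \<open>A monotone rate that is at most \<open>p\<close> at the end of the interval is at most
  \<open>p\<close> throughout, and equal sets of past arrivals mean that no claim falls in
  between.\<close>

lemma ctrl_surplus_mono_between_arrivals:
  assumes C: "mono_on {0..} (\<lambda>s. C s \<omega>)"
    and "0 \<le> a" "a \<le> b" and "C b \<omega> \<le> p"
    and "{i. arrival T i \<omega> \<le> a} = {i. arrival T i \<omega> \<le> b}"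
  shows "ctrl_surplus p T U x C a \<omega> \<le> ctrl_surplus p T U x C b \<omega>"
proof -
  have "integral {a..b} (\<lambda>s. C s \<omega>) \<le> integral {a..b} (\<lambda>s. p)"
  proof (rule integral_le)
    show "(\<lambda>s. C s \<omega>) integrable_on {a..b}" by (rule mono_rate_integrable) fact+
    fix s assume "s \<in> {a..b}"
    with assms(4) mono_onD[OF C, of s b] assms(2) show "C s \<omega> \<le> p" by auto
  qed auto
  then have "integral {a..b} (\<lambda>s. C s \<omega>) \<le> p * (b - a)"
    using \<open>a \<le> b\<close> by (simp add: algebra_simps)
  then show ?thesis
    unfolding ctrl_surplus_def surplus_def rate_integral_split[OF C assms(2,3)]
    by (simp add: algebra_simps assms(5))
qed

lemma ctrl_surplus_ge_perturbed:
  assumes C: "mono_on {0..} (\<lambda>s. C s \<omega>)" and D: "mono_on {0..} (\<lambda>s. D s \<omega>)"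
    and "0 \<le> t" and DC: "\<And>s. 0 \<le> s \<Longrightarrow> D s \<omega> \<le> C s \<omega> + d"
  shows "ctrl_surplus p T U x C t \<omega> - d * t \<le> ctrl_surplus p T U x D t \<omega>"
proof -
  have "integral {0..t} (\<lambda>s. D s \<omega>) \<le> integral {0..t} (\<lambda>s. C s \<omega> + d)"
    by (intro integral_le integrable_add integrable_const_ivl mono_rate_integrable C D)
      (use DC in auto)
  also have "\<dots> = integral {0..t} (\<lambda>s. C s \<omega>) + d * t"
    using \<open>0 \<le> t\<close> by (subst integral_add) (auto intro!: mono_rate_integrable C integrable_const_ivl)
  finally show ?thesis by (simp add: ctrl_surplus_def)
qed

section \<open>Ruin times and their stability under small changes of the rate\<close>

lemma ctrl_surplus_nonneg_before_ruin:
  assumes "0 \<le> s" and "ereal s < ruin_time p T U x C \<omega>"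
  shows "0 \<le> ctrl_surplus p T U x C s \<omega>"
proof (rule ccontr)
  assume "\<not> ?thesis"
  then have "ruin_time p T U x C \<omega> \<le> ereal s"
    unfolding ruin_time_def using assms(1) by (intro Inf_lower) auto
  with assms(2) show False by simp
qed

lemma ruin_time_ge:
  assumes "\<And>t. 0 \<le> t \<Longrightarrow> t \<le> s \<Longrightarrow> 0 \<le> ctrl_surplus p T U x C t \<omega>"
  shows "ereal s \<le> ruin_time p T U x C \<omega>"
  unfolding ruin_time_def
proof (rule Inf_greatest, clarify)
  fix t :: real assume "0 \<le> t" "ctrl_surplus p T U x C t \<omega> < 0"
  with assms[of t] show "ereal s \<le> ereal t" by fastforce
qed

lemma later_time_before_ruin:
  assumes "ereal s < ruin_time p T U x C \<omega>"
  obtains s' where "s < s'" and "ereal s' < ruin_time p T U x C \<omega>"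
  using ereal_dense2[OF assms] that by auto

text \<open>The convention on the rate \<open>p\<close> holds automatically on regular paths: once the surplus is
  zero and the rate is at least \<open>p\<close>, any further increase of the rate means immediate ruin.\<close>

lemma rate_stays_at_premium:
  assumes reg: "regular_path T U \<omega>" and C: "mono_on {0..} (\<lambda>s. C s \<omega>)"
    and "0 \<le> t" and "p \<le> C t \<omega>" and X0: "ctrl_surplus p T U x C t \<omega> = 0"
    and "t \<le> s" and s: "ereal s < ruin_time p T U x C \<omega>"
  shows "C s \<omega> = p"
proof (rule ccontr)
  assume "C s \<omega> \<noteq> p"
  moreover have "C t \<omega> \<le> C s \<omega>" using assms by (intro mono_onD[OF C]) auto
  ultimately have gt: "p < C s \<omega>" using assms by simp
  obtain s' where s': "s < s'" "ereal s' < ruin_time p T U x C \<omega>"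
    using later_time_before_ruin[OF s] .
  have "ctrl_surplus p T U x C s' \<omega>
      \<le> ctrl_surplus p T U x C s \<omega> + (p - C s \<omega>) * (s' - s)"
    using assms s' by (intro ctrl_surplus_le[where C=C and \<omega>=\<omega>, OF reg C]) auto
  also have "ctrl_surplus p T U x C s \<omega> \<le> 0"
    using ctrl_surplus_le[where C=C and \<omega>=\<omega>, OF reg C \<open>0 \<le> t\<close> \<open>t \<le> s\<close> \<open>p \<le> C t \<omega>\<close>, of p x] X0 by simp
  finally have "ctrl_surplus p T U x C s' \<omega> \<le> (p - C s \<omega>) * (s' - s)" by simp
  also have "\<dots> < 0" using gt s' by (simp add: mult_neg_pos)
  finally show False
    using ctrl_surplus_nonneg_before_ruin[of s' p T U x C \<omega>] s' assms by simp
qed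

text \<open>Survival rests on finitely many strict inequalities: positive surplus at each claim up
  to some \<open>s'\<close> beyond \<open>s\<close>, by \<open>nz\<close>, and at \<open>s'\<close>
  itself if the rate there exceeds \<open>p\<close>. A perturbation of size \<open>d n * s'\<close>
  eventually preserves all of them; in between, monotonicity and \<open>Dp\<close> prevent a
  dip.\<close>

lemma ruin_time_eventually_later:
  assumes reg: "regular_path T U \<omega>" and C: "mono_on {0..} (\<lambda>s. C s \<omega>)"
    and D: "\<And>n. mono_on {0..} (\<lambda>s. D n s \<omega>)"
    and DC: "\<And>n s. 0 \<le> s \<Longrightarrow> D n s \<omega> \<le> C s \<omega> + d n"
    and Dp: "\<And>n s. 0 \<le> s \<Longrightarrow> C s \<omega> \<le> p \<Longrightarrow> D n s \<omega> \<le> p"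
    and d: "d \<longlonglongrightarrow> 0" "\<And>n. 0 \<le> d n"
    and nz: "\<And>i. ctrl_surplus p T U x C (arrival T i \<omega>) \<omega> \<noteq> 0"
    and "0 \<le> x" "0 \<le> s" and s: "ereal s < ruin_time p T U x C \<omega>"
  shows "eventually (\<lambda>n. ereal s < ruin_time p T U x (D n) \<omega>) sequentially"
proof -
  let ?X = "\<lambda>t. ctrl_surplus p T U x C t \<omega>"
  let ?S = "\<lambda>i. arrival T i \<omega>"
  obtain s' where s': "s < s'" "ereal s' < ruin_time p T U x C \<omega>"
    using later_time_before_ruin[OF s] .
  have s'0: "0 < s'" using s' assms by simp
  have X_nonneg: "0 \<le> ?X t" if "0 \<le> t" "t \<le> s'" for t
    using that s'(2) by (intro ctrl_surplus_nonneg_before_ruin) (auto intro: le_less_trans[of "ereal t" "ereal s'"])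
  have X_arr: "0 < ?X (?S i)" if "?S i \<le> s'" for i
    using X_nonneg[of "?S i"] that arrival_pos[OF reg, of i] nz[of i] by simp
  \<comment> \<open>If the surplus vanished at \<open>s'\<close> under a rate above
    \<open>p\<close>, ruin would follow immediately; the still later time \<open>s''\<close> before
    ruin excludes this.\<close>
  have X_end: "0 < ?X s'" if "p < C s' \<omega>"
  proof -
    obtain s'' where s'': "s' < s''" "ereal s'' < ruin_time p T U x C \<omega>"
      using later_time_before_ruin[OF s'(2)] .
    have "0 \<le> ?X s''" using s'' s'0 by (intro ctrl_surplus_nonneg_before_ruin) auto
    also have "\<dots> \<le> ?X s' + (p - C s' \<omega>) * (s'' - s')"
      using s'' s'0 by (intro ctrl_surplus_le[where C=C and \<omega>=\<omega>, OF reg C]) auto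
    also have "\<dots> < ?X s'" using that s'' by (simp add: mult_neg_pos)
    finally show ?thesis .
  qed
  have dt: "(\<lambda>n. d n * t) \<longlonglongrightarrow> 0" for t
    using tendsto_mult_right[OF d(1), of t] by simp
  have ev_arr: "eventually (\<lambda>n. \<forall>i\<in>{i. ?S i \<le> s'}. d n * s' < ?X (?S i)) sequentially"
    using finite_arrivals_before[OF reg] order_tendstoD(2)[OF dt X_arr]
    by (intro eventually_ball_finite) auto
  have ev_end: "eventually (\<lambda>n. p < C s' \<omega> \<longrightarrow> d n * s' < ?X s') sequentially"
    using order_tendstoD(2)[OF dt X_end] by (cases "p < C s' \<omega>") auto
  show ?thesis
    using ev_arr ev_end
  proof eventually_elim
    case (elim n)
    let ?Y = "\<lambda>t. ctrl_surplus p T U x (D n) t \<omega>"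
    have cmp: "?X t - d n * s' \<le> ?Y t" if "0 \<le> t" "t \<le> s'" for t
      using ctrl_surplus_ge_perturbed[where C=C and \<omega>=\<omega> and D="D n" and t=t and d="d n" and p=p and T=T and U=U and x=x, OF C D that(1) DC]
        mult_left_mono[OF that(2) d(2)[of n]] by simp
    \<comment> \<open>If \<open>C\<close> already pays more than \<open>p\<close> at
      \<open>t\<close>, its surplus does not rise from \<open>t\<close> to \<open>s'\<close>, so the
      margin at \<open>s'\<close> serves at \<open>t\<close> too. Otherwise \<open>D n\<close> has
      paid at most \<open>p\<close> up to \<open>t\<close>, and its surplus has not fallen since the
      last claim, or since time 0.\<close>
    have "0 \<le> ?Y t" if t: "0 \<le> t" "t \<le> s'" for t
    proof (cases "C t \<omega> \<le> p")
      case False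
      have "C t \<omega> \<le> C s' \<omega>" using t by (intro mono_onD[OF C]) auto
      with False elim have "d n * s' < ?X s'" by simp
      also have "?X s' \<le> ?X t"
        using ctrl_surplus_le[where C=C and \<omega>=\<omega>, OF reg C t, of p p x] False by simp
      finally show ?thesis using cmp[OF t] by simp
    next
      case True
      then have Dt: "D n t \<omega> \<le> p" using Dp t by simp
      show ?thesis
      proof (cases "{i. ?S i \<le> t} = {}")
        case empty: True
        then have "{i. ?S i \<le> 0} = {i. ?S i \<le> t}" using t by (auto dest: order_trans)
        then have "?Y 0 \<le> ?Y t"
          using t Dt by (intro ctrl_surplus_mono_between_arrivals[where C="D n" and \<omega>=\<omega>] D) auto
        moreover have "{i. ?S i \<le> 0} = {}"
          using arrival_pos[OF reg] by (simp add: not_le)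
        then have "?Y 0 = x"
          by (simp add: ctrl_surplus_def surplus_def)
        ultimately show ?thesis using \<open>0 \<le> x\<close> by simp
      next
        case False
        define m where "m = Max {i. ?S i \<le> t}"
        have m: "?S m \<le> t" "\<And>i. ?S i \<le> t \<Longrightarrow> i \<le> m"
          using Max_in[OF finite_arrivals_before[OF reg] False]
            Max_ge[OF finite_arrivals_before[OF reg]]
          by (auto simp: m_def)
        have "{i. ?S i \<le> ?S m} = {i. ?S i \<le> t}"
          using m strict_mono_less_eq[OF arrival_strict_mono[OF reg]] by (auto intro: order_trans)
        then have "?Y (?S m) \<le> ?Y t"
          using m Dt arrival_pos[OF reg, of m]
          by (intro ctrl_surplus_mono_between_arrivals[where C="D n" and \<omega>=\<omega>] D) auto
        moreover have "d n * s' < ?X (?S m)" using elim(1) m(1) t by simp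
        then have "0 < ?Y (?S m)"
          using cmp[of "?S m"] m(1) t arrival_pos[OF reg, of m] by simp
        ultimately show ?thesis by simp
      qed
    qed
    then have "ereal s' \<le> ruin_time p T U x (D n) \<omega>" by (rule ruin_time_ge)
    then show ?case using s' by (auto intro: less_le_trans[of "ereal s" "ereal s'"])
  qed
qed

section \<open>Rounding to a grid\<close>

text \<open>Plain rounding down could fall below \<open>c\<close> when \<open>c\<close> is off the
  grid, which is inadmissible. The cut-off at the least grid point not below \<open>c\<close>
  prevents this and costs at most one mesh width.\<close>

definition round_rate :: "real set \<Rightarrow> real \<Rightarrow> real \<Rightarrow> real" where
  "round_rate G c y = Max {g \<in> G. g \<le> max y (Min {g \<in> G. c \<le> g})}"

lemma round_rate_props:
  assumes G: "finite G" and ex: "\<exists>g\<in>G. c \<le> g"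
  shows round_rate_in: "round_rate G c y \<in> G"
    and round_rate_le: "round_rate G c y \<le> max y (Min {g \<in> G. c \<le> g})"
    and round_rate_ge: "c \<le> round_rate G c y"
    and round_rate_greatest: "g \<in> G \<Longrightarrow> g \<le> y \<Longrightarrow> g \<le> round_rate G c y"
    and round_rate_mono: "mono (round_rate G c)"
proof -
  let ?g0 = "Min {g \<in> G. c \<le> g}"
  let ?A = "\<lambda>y. {g \<in> G. g \<le> max y ?g0}"
  have g0: "?g0 \<in> {g \<in> G. c \<le> g}" using G ex by (intro Min_in) auto
  have ne: "?A y \<noteq> {}" for y using g0 by auto
  have fin: "finite (?A y)" for y using G by simp
  from Max_in[OF fin ne, of y] show "round_rate G c y \<in> G" "round_rate G c y \<le> max y ?g0"
    by (auto simp: round_rate_def)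
  have "?g0 \<le> round_rate G c y"
    unfolding round_rate_def using g0 by (intro Max_ge fin) auto
  with g0 show "c \<le> round_rate G c y" by simp
  show "g \<in> G \<Longrightarrow> g \<le> y \<Longrightarrow> g \<le> round_rate G c y"
    unfolding round_rate_def by (intro Max_ge fin) auto
  show "mono (round_rate G c)"
    unfolding round_rate_def
    by (intro monoI Max_mono fin ne) (auto simp: le_max_iff_disj)
qed

text \<open>One bound with two uses: with a grid point just above \<open>y\<close> it controls the
  rounding error, with \<open>g = p\<close> it keeps rates from crossing \<open>p\<close>.\<close>

lemma round_rate_le_of_le:
  assumes "finite G" and "g \<in> G" and "c \<le> g" and "y \<le> g"
  shows "round_rate G c y \<le> g"
proof -
  have "Min {g \<in> G. c \<le> g} \<le> g" using assms by (intro Min_le) auto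
  then have "max y (Min {g \<in> G. c \<le> g}) \<le> g" using assms by simp
  moreover have "round_rate G c y \<le> max y (Min {g \<in> G. c \<le> g})"
    using assms by (intro round_rate_le) auto
  ultimately show ?thesis by (rule order_trans[rotated])
qed

text \<open>Rounding down is a step function that jumps only on reaching a grid point, so it is
  constant from \<open>y\<close> up to the next one. This keeps the rounded process
  right-continuous.\<close>

lemma round_rate_eventually_const_right:
  assumes G: "finite G"
  shows "\<exists>e>y. \<forall>z\<in>{y..<e}. round_rate G c z = round_rate G c y"
proof -
  obtain e where e: "y < e" "\<forall>g\<in>G. y < g \<longrightarrow> e \<le> g"
  proof (cases "{g \<in> G. y < g} = {}")
    case True
    then show ?thesis by (intro that[of "y + 1"]) auto
  next
    case False
    with G have "Min {g \<in> G. y < g} \<in> {g \<in> G. y < g}" by (intro Min_in) auto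
    then show ?thesis using G by (intro that[of "Min {g \<in> G. y < g}"]) auto
  qed
  have "g \<le> z \<longleftrightarrow> g \<le> y" if "z \<in> {y..<e}" "g \<in> G" for z g
  proof
    assume "g \<le> z"
    then show "g \<le> y" using e(2) that by (cases "y < g") auto
  qed (use that in auto)
  then have *: "{g \<in> G. g \<le> max z m} = {g \<in> G. g \<le> max y m}" if "z \<in> {y..<e}" for z m
    unfolding le_max_iff_disj using that by blast
  have "round_rate G c z = round_rate G c y" if "z \<in> {y..<e}" for z
    unfolding round_rate_def *[OF that] ..
  with e(1) show ?thesis by blast
qed

lemma round_rate_right_continuous:
  fixes f :: "real \<Rightarrow> real"
  assumes G: "finite G" and f: "mono_on {0..} f" and "0 \<le> t" and ct: "continuous (at_right t) f"
  shows "continuous (at_right t) (\<lambda>s. round_rate G c (f s))"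
proof -
  obtain e where e: "f t < e" "\<forall>z\<in>{f t..<e}. round_rate G c z = round_rate G c (f t)"
    using round_rate_eventually_const_right[OF G, of "f t" c] by auto
  have "(f \<longlongrightarrow> f t) (at_right t)" using ct by (simp add: continuous_within)
  then have "eventually (\<lambda>s. f s < e) (at_right t)" using e(1) by (rule order_tendstoD(2))
  moreover have "eventually (\<lambda>s. f t \<le> f s) (at_right t)"
    using eventually_at_right_less[of t]
  proof eventually_elim
    case (elim s)
    then show ?case using \<open>0 \<le> t\<close> by (intro mono_onD[OF f]) auto
  qed
  ultimately have "eventually (\<lambda>s. round_rate G c (f s) = round_rate G c (f t)) (at_right t)"
  proof eventually_elim
    case (elim s)
    then show ?case by (intro e(2)[rule_format]) simp
  qed
  then show ?thesis
    unfolding continuous_within by (rule tendsto_eventually)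
qed

section \<open>The dyadic grid and its mesh\<close>

lemma finite_grid: "finite (grid p cbar n)"
  by (simp add: grid_def setcompr_eq_image)

lemma gridI: "real k = z \<Longrightarrow> k \<le> 2 ^ n \<Longrightarrow> z * cbar / 2 ^ n \<in> grid p cbar n"
  unfolding grid_def by blast

lemma grid_bounds:
  assumes "0 < cbar" and "0 < p" and "g \<in> grid p cbar n"
  shows "0 \<le> g" and "g \<le> cbar"
proof -
  have "real k * cbar / 2 ^ n \<le> cbar" if "k \<le> 2 ^ n" for k
  proof -
    have "real k \<le> 2 ^ n" using that by (metis of_nat_le_iff of_nat_numeral of_nat_power)
    then show ?thesis using assms(1) by (simp add: divide_simps mult_right_mono)
  qed
  then show "0 \<le> g" "g \<le> cbar" using assms by (auto simp: grid_def split: if_splits)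
qed

lemma grid_cbar: "cbar \<in> grid p cbar n"
  using gridI[of "2 ^ n" "2 ^ n" n cbar p] by simp

lemma grid_premium: "p \<le> cbar \<Longrightarrow> p \<in> grid p cbar n"
  using grid_cbar[of cbar p n] by (cases "p = cbar") (auto simp: grid_def)

lemma grid_dense:
  assumes "0 < cbar" and "0 \<le> y" and "y \<le> cbar"
  shows grid_below: "\<exists>g\<in>grid p cbar n. y - cbar / 2 ^ n \<le> g \<and> g \<le> y"
    and grid_above: "\<exists>g\<in>grid p cbar n. y \<le> g \<and> g \<le> y + cbar / 2 ^ n"
proof -
  \<comment> \<open>\<open>z\<close> is \<open>y\<close> in units of the mesh; its floor and ceiling
    index the neighbouring grid points.\<close>
  define z where "z = y * 2 ^ n / cbar"
  have z: "0 \<le> z" "z \<le> 2 ^ n" using assms by (auto simp: z_def divide_simps mult_right_mono)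
  have y: "y = z * cbar / 2 ^ n" using assms(1) by (simp add: z_def)
  have scale: "u * cbar / 2 ^ n \<le> v * cbar / 2 ^ n" if "u \<le> v" for u v
    using that assms(1) by (intro divide_right_mono mult_right_mono) auto
  have "\<lfloor>z\<rfloor> \<le> 2 ^ n" "\<lceil>z\<rceil> \<le> 2 ^ n" using z by (simp_all add: floor_le_iff ceiling_le_iff)
  moreover have "real (nat \<lfloor>z\<rfloor>) = of_int \<lfloor>z\<rfloor>" "real (nat \<lceil>z\<rceil>) = of_int \<lceil>z\<rceil>"
    using z(1) by auto
  moreover have "nat \<lfloor>z\<rfloor> \<le> 2 ^ n" "nat \<lceil>z\<rceil> \<le> 2 ^ n"
    using calculation by (simp_all add: nat_le_iff)
  ultimately have in_grid: "of_int \<lfloor>z\<rfloor> * cbar / 2 ^ n \<in> grid p cbar n" "of_int \<lceil>z\<rceil> * cbar / 2 ^ n \<in> grid p cbar n"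
    by - (rule gridI; assumption)+
  have "(z - 1) * cbar / 2 ^ n = y - cbar / 2 ^ n" "(z + 1) * cbar / 2 ^ n = y + cbar / 2 ^ n"
    by (simp_all add: y left_diff_distrib diff_divide_distrib distrib_right add_divide_distrib)
  with scale[of "z - 1" "of_int \<lfloor>z\<rfloor>"] scale[of "of_int \<lfloor>z\<rfloor>" z]
    scale[of "of_int \<lceil>z\<rceil>" "z + 1"] scale[of z "of_int \<lceil>z\<rceil>"]
  have "y - cbar / 2 ^ n \<le> of_int \<lfloor>z\<rfloor> * cbar / 2 ^ n" "of_int \<lfloor>z\<rfloor> * cbar / 2 ^ n \<le> y"
    "y \<le> of_int \<lceil>z\<rceil> * cbar / 2 ^ n" "of_int \<lceil>z\<rceil> * cbar / 2 ^ n \<le> y + cbar / 2 ^ n"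
    unfolding y[symmetric] by linarith+
  with in_grid show "\<exists>g\<in>grid p cbar n. y - cbar / 2 ^ n \<le> g \<and> g \<le> y"
    "\<exists>g\<in>grid p cbar n. y \<le> g \<and> g \<le> y + cbar / 2 ^ n"
    by blast+
qed

lemma round_rate_grid:
  assumes "0 < cbar" and "0 < p" and "0 \<le> c" and "c \<le> y" and "y \<le> cbar"
  shows round_rate_grid_close: "\<bar>round_rate (grid p cbar n) c y - y\<bar> \<le> cbar / 2 ^ n"
    and round_rate_grid_premium: "y \<le> p \<Longrightarrow> round_rate (grid p cbar n) c y \<le> p"
proof -
  let ?r = "round_rate (grid p cbar n) c y"
  have ex: "\<exists>g\<in>grid p cbar n. c \<le> g" using grid_cbar assms by (intro bexI[of _ cbar]) auto
  obtain g where "g \<in> grid p cbar n" "y - cbar / 2 ^ n \<le> g" "g \<le> y"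
    using grid_below[of cbar y p n] assms by auto
  moreover have "g \<le> ?r" using calculation by (intro round_rate_greatest[OF finite_grid ex])
  moreover obtain h where "h \<in> grid p cbar n" "y \<le> h" "h \<le> y + cbar / 2 ^ n"
    using grid_above[of cbar y p n] assms by auto
  moreover have "?r \<le> h" using calculation assms by (intro round_rate_le_of_le finite_grid) auto
  ultimately show "\<bar>?r - y\<bar> \<le> cbar / 2 ^ n" by linarith
  assume "y \<le> p"
  \<comment> \<open>If \<open>p\<close> is at most \<open>cbar\<close>, it is a grid point that
    dominates both \<open>c\<close> and \<open>y\<close>; otherwise the whole grid lies below
    \<open>p\<close>.\<close>
  show "?r \<le> p"
  proof (cases "p \<le> cbar")
    case True
    then show ?thesis using \<open>y \<le> p\<close> assms by (intro round_rate_le_of_le finite_grid grid_premium) auto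
  next
    case False
    then show ?thesis using grid_bounds(2)[OF assms(1,2) round_rate_in[OF finite_grid ex], of y] by simp
  qed
qed

section \<open>Monotone right-continuous rates\<close>

text \<open>Moving the time to a nearby grid point on its right gives functions that are jointly
  measurable, as only countably many times enter; right-continuity makes them converge pointwise as
  the mesh shrinks.\<close>

lemma right_continuous_jointly_measurable:
  fixes f :: "real \<Rightarrow> 'a \<Rightarrow> real"
  assumes f: "\<And>t. 0 \<le> t \<Longrightarrow> f t \<in> borel_measurable N"
    and ct: "\<And>\<omega> t. \<omega> \<in> space N \<Longrightarrow> 0 \<le> t \<Longrightarrow> continuous (at_right t) (\<lambda>s. f s \<omega>)"
  shows "(\<lambda>(\<omega>, s). if 0 \<le> s then f s \<omega> else 0) \<in> borel_measurable (N \<Otimes>\<^sub>M lborel)"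
proof -
  \<comment> \<open>The floor plus one makes \<open>a m s\<close> strictly larger than
    \<open>s\<close>, even when \<open>s\<close> is a multiple of the mesh, as convergence along
    \<open>at_right s\<close> requires.\<close>
  define a :: "nat \<Rightarrow> real \<Rightarrow> real" where "a m s = (of_int \<lfloor>s * real (Suc m)\<rfloor> + 1) / real (Suc m)" for m s
  have a: "s < a m s" "a m s \<le> s + 1 / real (Suc m)" for m s
  proof -
    have "s < (of_int \<lfloor>s * c\<rfloor> + 1) / c \<and> (of_int \<lfloor>s * c\<rfloor> + 1) / c \<le> s + 1 / c" if "0 < c" for c
      using that by (simp add: pos_less_divide_eq pos_divide_le_eq distrib_right)
    then show "s < a m s" "a m s \<le> s + 1 / real (Suc m)"
      unfolding a_def by simp_all
  qed
  have lim: "filterlim (\<lambda>m. a m s) (at_right s) sequentially" for s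
    unfolding filterlim_at
  proof
    show "eventually (\<lambda>m. a m s \<in> {s<..} \<and> a m s \<noteq> s) sequentially"
      using a(1)[of s] by (auto intro!: always_eventually simp: less_imp_neq[THEN not_sym])
    have "(\<lambda>m. s + 1 / real (Suc m)) \<longlonglongrightarrow> s + 0"
      by (intro tendsto_intros LIMSEQ_Suc lim_1_over_n)
    then show "(\<lambda>m. a m s) \<longlonglongrightarrow> s"
      by (intro tendsto_sandwich[of "\<lambda>m. s" "\<lambda>m. a m s" sequentially "\<lambda>m. s + 1 / real (Suc m)" s])
        (use a in \<open>auto intro!: always_eventually less_imp_le\<close>)
  qed
  show ?thesis
  proof (rule borel_measurable_LIMSEQ_real)
    let ?u = "\<lambda>m z. if 0 \<le> snd z then f (a m (snd z)) (fst z) else (0 :: real)"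
    show "(\<lambda>m. ?u m z) \<longlonglongrightarrow> (case z of (\<omega>, s) \<Rightarrow> if 0 \<le> s then f s \<omega> else 0)"
      if z: "z \<in> space (N \<Otimes>\<^sub>M lborel)" for z
    proof (cases "0 \<le> snd z")
      case True
      have "((\<lambda>s. f s (fst z)) \<longlongrightarrow> f (snd z) (fst z)) (at_right (snd z))"
        using ct[of "fst z" "snd z"] z True
        by (auto simp: continuous_within space_pair_measure)
      from filterlim_compose[OF this lim] show ?thesis
        using True by (simp add: case_prod_beta)
    qed (simp add: case_prod_beta)
    fix m
    \<comment> \<open>For nonnegative times the floor is a natural number \<open>k\<close>; with
      \<open>k\<close> fixed, only one time slice of \<open>f\<close> is involved.\<close>
    define g where "g k z = (if 0 \<le> snd z then f ((real k + 1) / Suc m) (fst z) else 0)" for k :: nat and z :: "'a \<times> real"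
    have "(\<lambda>z. g (nat \<lfloor>snd z * real (Suc m)\<rfloor>) z) \<in> borel_measurable (N \<Otimes>\<^sub>M lborel)"
    proof (rule measurable_compose_countable)
      fix k :: nat
      have [measurable]: "f ((real k + 1) / Suc m) \<in> borel_measurable N" by (intro f) simp
      show "(\<lambda>z. g k z) \<in> borel_measurable (N \<Otimes>\<^sub>M lborel)" unfolding g_def by measurable
    next
      show "(\<lambda>z. nat \<lfloor>snd z * real (Suc m)\<rfloor>) \<in> measurable (N \<Otimes>\<^sub>M lborel) (count_space UNIV)" by measurable
    qed
    moreover have "g (nat \<lfloor>snd z * real (Suc m)\<rfloor>) z = ?u m z" for z
      by (auto simp: g_def a_def)
    ultimately show "?u m \<in> borel_measurable (N \<Otimes>\<^sub>M lborel)" by simp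
  qed
qed

text \<open>As a Lebesgue integral over the whole line, the cumulated rate falls under joint
  measurability in path and time. The strict condition \<open>s < r\<close> matches events saying
  that a random time is later than \<open>s\<close>; the omitted end point is a null set.\<close>

lemma rate_integral_eq_lborel:
  fixes f :: "real \<Rightarrow> real"
  assumes f: "mono_on {0..} f" and bd: "\<And>s. 0 \<le> s \<Longrightarrow> 0 \<le> f s \<and> f s \<le> b"
  shows "integral {0..r} f = (\<integral>s. (if 0 \<le> s then if s < r then f s else 0 else 0) \<partial>lborel)"
proof -
  let ?g = "\<lambda>s. if 0 \<le> s then if s < r then f s else 0 else 0"
  have "mono (\<lambda>s. if 0 \<le> s then f s else 0)"
    using bd mono_onD[OF f] by (auto intro!: monoI)
  then have [measurable]: "(\<lambda>s. if 0 \<le> s then f s else 0) \<in> borel_measurable borel"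
    by (rule borel_measurable_mono)
  have "(\<lambda>s. if s < r then (if 0 \<le> s then f s else 0) else 0) \<in> borel_measurable borel"
    by measurable
  moreover have "(\<lambda>s. if s < r then (if 0 \<le> s then f s else 0) else 0) = ?g" by auto
  ultimately have g: "?g \<in> borel_measurable lborel" by simp
  have int: "integrable lborel ?g"
  proof (rule Bochner_Integration.integrable_bound)
    show "integrable lborel (\<lambda>s. indicator {0..r} s *\<^sub>R b)"
      by (intro integrable_scaleR_left integrable_real_indicator)
        (auto simp: emeasure_lborel_Icc_eq)
    show "AE s in lborel. norm (?g s) \<le> norm (indicator {0..r} s *\<^sub>R b)"
    proof (rule AE_I2)
      fix s
      show "norm (?g s) \<le> norm (indicator {0..r} s *\<^sub>R b)"
        using bd[of s] by (cases "s \<in> {0..r}") auto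
    qed
  qed (rule g)
  have "(\<integral>s. ?g s \<partial>lborel) = integral UNIV ?g"
    using has_integral_integral_lborel[OF int] by (simp add: integral_unique)
  also have "\<dots> = integral UNIV (\<lambda>s. if s \<in> {0..r} then f s else 0)"
    by (rule integral_spike[of "{r}"]) auto
  also have "\<dots> = integral {0..r} f" by (rule integral_restrict_UNIV)
  finally show ?thesis ..
qed

text \<open>Measurability is asked only of the part of \<open>C\<close> before the random time
  \<open>S\<close>. At an arrival time this is what is available, since the rate is known to avoid
  the arriving claim only beforehand.\<close>

lemma rate_integral_measurable:
  fixes C :: "real \<Rightarrow> 'a \<Rightarrow> real"
  assumes S: "S \<in> borel_measurable N"
    and ad: "\<And>t. 0 \<le> t \<Longrightarrow> (\<lambda>\<omega>. if t < S \<omega> then C t \<omega> else 0) \<in> borel_measurable N"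
    and mono: "\<And>\<omega>. \<omega> \<in> space N \<Longrightarrow> mono_on {0..} (\<lambda>s. C s \<omega>)"
    and bd: "\<And>\<omega> t. \<omega> \<in> space N \<Longrightarrow> 0 \<le> t \<Longrightarrow> 0 \<le> C t \<omega> \<and> C t \<omega> \<le> b"
    and rc: "\<And>\<omega> t. \<omega> \<in> space N \<Longrightarrow> 0 \<le> t \<Longrightarrow> continuous (at_right t) (\<lambda>s. C s \<omega>)"
  shows "(\<lambda>\<omega>. integral {0..S \<omega>} (\<lambda>s. C s \<omega>)) \<in> borel_measurable N"
proof -
  let ?f = "\<lambda>s \<omega>. if s < S \<omega> then C s \<omega> else 0"
  \<comment> \<open>Cutting off at \<open>S\<close> preserves right-continuity: the condition
    \<open>s < S \<omega>\<close> persists for a while to the right when it holds, and stays false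
    once it fails.\<close>
  have "(\<lambda>(\<omega>, s). if 0 \<le> s then ?f s \<omega> else 0) \<in> borel_measurable (N \<Otimes>\<^sub>M lborel)"
  proof (rule right_continuous_jointly_measurable)
    fix t :: real assume "0 \<le> t"
    then show "?f t \<in> borel_measurable N" by (rule ad)
    fix \<omega> assume \<omega>: "\<omega> \<in> space N"
    show "continuous (at_right t) (\<lambda>s. ?f s \<omega>)"
    proof (cases "t < S \<omega>")
      case True
      then have "eventually (\<lambda>s. s < S \<omega>) (at_right t)" by (simp add: eventually_at_right_real eventually_at_right)
          (metis order.strict_trans)
      then have "eventually (\<lambda>s. C s \<omega> = ?f s \<omega>) (at_right t)" by eventually_elim simp
      moreover have "((\<lambda>s. C s \<omega>) \<longlongrightarrow> C t \<omega>) (at_right t)"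
        using rc[OF \<omega> \<open>0 \<le> t\<close>] by (simp add: continuous_within)
      ultimately have "((\<lambda>s. ?f s \<omega>) \<longlongrightarrow> C t \<omega>) (at_right t)"
        by (rule Lim_transform_eventually[rotated])
      then show ?thesis using True by (simp add: continuous_within)
    next
      case False
      have "eventually (\<lambda>s. t < s) (at_right t)" by (rule eventually_at_right_less)
      then have "eventually (\<lambda>s. ?f s \<omega> = 0) (at_right t)"
        by eventually_elim (use False in auto)
      then have "((\<lambda>s. ?f s \<omega>) \<longlongrightarrow> 0) (at_right t)" by (rule tendsto_eventually)
      then show ?thesis using False by (simp add: continuous_within)
    qed
  qed
  from lborel.borel_measurable_lebesgue_integral[OF this]
  have "(\<lambda>\<omega>. \<integral>s. (if 0 \<le> s then ?f s \<omega> else 0) \<partial>lborel) \<in> borel_measurable N" .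
  then show ?thesis
    by (rule measurable_cong[THEN iffD1, rotated])
      (rule rate_integral_eq_lborel[symmetric, OF mono bd])
qed

lemma mono_on_left_limit:
  fixes f :: "real \<Rightarrow> real"
  assumes f: "mono_on {0..} f" and "0 < t"
  shows "\<exists>l. (f \<longlongrightarrow> l) (at_left t)"
proof -
  have in_I: "eventually (\<lambda>s. s \<in> {0<..<t}) (at_left t)"
    using \<open>0 < t\<close> by (rule eventually_at_left_real)
  have bdd: "bdd_above (f ` {0<..<t})"
    using \<open>0 < t\<close> by (intro bdd_aboveI[of _ "f t"]) (auto intro!: mono_onD[OF f])
  have "(f \<longlongrightarrow> Sup (f ` {0<..<t})) (at_left t)"
  proof (rule increasing_tendsto)
    show "eventually (\<lambda>s. f s \<le> Sup (f ` {0<..<t})) (at_left t)"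
      using in_I by eventually_elim (intro cSup_upper bdd imageI)
    fix y assume "y < Sup (f ` {0<..<t})"
    then obtain u where u: "u \<in> {0<..<t}" "y < f u"
      using \<open>0 < t\<close> less_cSup_iff[OF _ bdd, of y] by auto
    have "eventually (\<lambda>s. s \<in> {u<..<t}) (at_left t)"
      using u by (intro eventually_at_left_real) simp
    then show "eventually (\<lambda>s. y < f s) (at_left t)"
    proof eventually_elim
      case (elim s)
      then have "f u \<le> f s" using u by (intro mono_onD[OF f]) auto
      with u show ?case by simp
    qed
  qed
  then show ?thesis ..
qed

lemma left_limit_le:
  fixes f :: "real \<Rightarrow> real"
  assumes f: "mono_on {0..} f" and "0 < t"
  shows "Lim (at_left t) f \<le> f t"
proof -
  obtain l where l: "(f \<longlongrightarrow> l) (at_left t)" using mono_on_left_limit[OF assms] ..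
  have "eventually (\<lambda>s. s \<in> {0<..<t}) (at_left t)"
    using \<open>0 < t\<close> by (rule eventually_at_left_real)
  then have "eventually (\<lambda>s. f s \<le> f t) (at_left t)"
  proof eventually_elim
    case (elim s)
    then show ?case by (intro mono_onD[OF f]) auto
  qed
  then have "l \<le> f t" by (intro tendsto_upperbound[OF l]) auto
  with tendsto_Lim[OF _ l] show ?thesis by simp
qed

section \<open>Independence of a claim from the preceding surplus\<close>

locale cramer_lundberg = prob_space M for M :: "'a measure" +
  fixes T U :: "nat \<Rightarrow> 'a \<Rightarrow> real" and F :: "real \<Rightarrow> real" and p \<beta> q cbar K :: real
  assumes premium_pos: "0 < p" and intensity_pos: "0 < \<beta>" and discount_pos: "0 < q" and cbar_pos: "0 < cbar"
    and T_exponential: "\<And>i. distributed M lborel (T i) (exponential_density \<beta>)"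
    and U_distribution: "\<And>i u. measure M {\<omega> \<in> space M. U i \<omega> \<le> u} = F u"
    and F_0: "F 0 = 0"
    and indep: "indep_vars (\<lambda>_. borel) (\<lambda>k. case k of Inl i \<Rightarrow> T i | Inr i \<Rightarrow> U i) UNIV"
    and K_pos: "0 < K" and F_lipschitz: "\<And>u v. \<bar>F u - F v\<bar> \<le> K * \<bar>u - v\<bar>"
begin

section \<open>Measurability of the model and almost sure regularity of its paths\<close>

lemma T_measurable [measurable]: "T i \<in> borel_measurable M"
proof -
  have "(case Inl i of Inl i \<Rightarrow> T i | Inr i \<Rightarrow> U i) \<in> borel_measurable M"
    using indep unfolding indep_vars_def2 by (elim conjE bspec) simp
  then show ?thesis by simp
qed

lemma U_measurable [measurable]: "U i \<in> borel_measurable M"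
proof -
  have "(case Inr i of Inl i \<Rightarrow> T i | Inr i \<Rightarrow> U i) \<in> borel_measurable M"
    using indep unfolding indep_vars_def2 by (elim conjE bspec) simp
  then show ?thesis by simp
qed

text \<open>The first \<open>n + 1\<close> independent waiting times all stay at or below
  \<open>t\<close> with probability \<open>r ^ Suc n\<close>, where \<open>r < 1\<close> is the
  probability for a single one. Non-explosion will follow.\<close>

lemma AE_T_unbounded:
  assumes "0 \<le> t"
  shows "AE \<omega> in M. \<exists>i. t < T i \<omega>"
proof -
  define r where "r = 1 - exp (- t * \<beta>)"
  have r: "0 \<le> r" "r < 1" using assms intensity_pos by (auto simp: r_def)
  let ?A = "{\<omega> \<in> space M. \<forall>i. T i \<omega> \<le> t}"
  have "prob ?A \<le> r ^ Suc n" for n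
  proof -
    let ?V = "\<lambda>k. case k of Inl i \<Rightarrow> T i | Inr i \<Rightarrow> U i"
    have "prob ?A \<le> prob (\<Inter>k\<in>Inl ` {..n}. ?V k -` {..t} \<inter> space M)"
      by (intro finite_measure_mono sets.finite_INT) auto
    also have "\<dots> = (\<Prod>k\<in>Inl ` {..n}. prob (?V k -` {..t} \<inter> space M))"
      by (intro indep_varsD[OF indep]) auto
    also have "\<dots> = (\<Prod>i\<le>n. prob (T i -` {..t} \<inter> space M))"
      by (subst prod.reindex) auto
    also have "\<dots> = (\<Prod>i\<le>n. r)"
    proof (intro prod.cong refl)
      fix i
      have "T i -` {..t} \<inter> space M = {\<omega> \<in> space M. T i \<omega> \<le> t}" by auto
      then show "prob (T i -` {..t} \<inter> space M) = r"
        using exponential_distributedD_le[OF T_exponential assms intensity_pos] by (simp add: r_def)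
    qed
    finally show ?thesis by simp
  qed
  moreover have "(\<lambda>n. r ^ Suc n) \<longlonglongrightarrow> 0" using r by (intro LIMSEQ_Suc LIMSEQ_power_zero) auto
  ultimately have "prob ?A \<le> 0" by (intro LIMSEQ_le_const) auto
  then have "prob ?A = 0" by (simp add: measure_le_0_iff)
  then have "AE \<omega> in M. \<not> (\<forall>i. T i \<omega> \<le> t)" by (subst (asm) prob_Collect_eq_0) auto
  then show ?thesis by (simp add: not_le)
qed

lemma AE_regular_path: "AE \<omega> in M. regular_path T U \<omega>"
proof -
  have "AE \<omega> in M. 0 < T i \<omega>" for i
  proof -
    have "prob {\<omega> \<in> space M. T i \<omega> \<le> 0} = 0"
      using exponential_distributedD_le[OF T_exponential order_refl intensity_pos] by simp
    then have "AE \<omega> in M. \<not> T i \<omega> \<le> 0" by (subst (asm) prob_Collect_eq_0) auto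
    then show ?thesis by (simp add: not_le)
  qed
  moreover have "AE \<omega> in M. 0 < U i \<omega>" for i
  proof -
    have "prob {\<omega> \<in> space M. U i \<omega> \<le> 0} = 0" using U_distribution[of i 0] F_0 by simp
    then have "AE \<omega> in M. \<not> U i \<omega> \<le> 0" by (subst (asm) prob_Collect_eq_0) auto
    then show ?thesis by (simp add: not_le)
  qed
  moreover have "AE \<omega> in M. \<forall>k::nat. \<exists>i. real k < T i \<omega>"
    using AE_T_unbounded by (simp add: AE_all_countable)
  ultimately have "AE \<omega> in M. (\<forall>i. 0 < T i \<omega>) \<and> (\<forall>i. 0 < U i \<omega>) \<and> (\<forall>k::nat. \<exists>i. real k < T i \<omega>)"
    by (simp add: AE_all_countable)
  then show ?thesis
  proof eventually_elim
    case (elim \<omega>)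
    have "\<exists>i. t < arrival T i \<omega>" for t
    proof -
      obtain k :: nat where "t < real k" using reals_Archimedean2 by blast
      moreover obtain i where "real k < T i \<omega>" using elim by blast
      \<comment> \<open>Waiting times being positive, an arrival time dominates its last waiting
        time, so one long wait already carries it past \<open>t\<close>.\<close>
      moreover have "T i \<omega> \<le> arrival T i \<omega>"
        unfolding arrival_def using elim by (intro member_le_sum) (auto intro: less_imp_le)
      ultimately show ?thesis by (intro exI[of _ i]) simp
    qed
    with elim show ?case by (simp add: regular_path_def)
  qed
qed

definition irregular :: "'a set" where
  "irregular = {\<omega> \<in> space M. \<not> regular_path T U \<omega>}"

lemma irregular_null: "irregular \<in> null_sets (completion M)"
proof -
  obtain N where N: "N \<in> null_sets M" "{\<omega> \<in> space M. \<not> regular_path T U \<omega>} \<subseteq> N"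
    using AE_E3[OF AE_regular_path] by (metis (no_types, lifting) DiffI mem_Collect_eq subsetI)
  then show ?thesis unfolding irregular_def null_sets_completion_iff2 by blast
qed

lemma subset_irregular_null: "A \<subseteq> irregular \<Longrightarrow> A \<in> null_sets (completion M)"
  by (rule null_sets_completion_subset[OF _ irregular_null])

text \<open>The sigma-algebra generated by all waiting times and all claims except
  \<open>U i\<close>, written as the pullback of a product so that independence of disjoint blocks
  of variables applies.\<close>

definition others :: "nat \<Rightarrow> 'a measure" where
  "others i = vimage_algebra (space M)
     (\<lambda>\<omega>. restrict (\<lambda>k. (case k of Inl j \<Rightarrow> T j | Inr j \<Rightarrow> U j) \<omega>) (UNIV - {Inr i}))
     (Pi\<^sub>M (UNIV - {Inr i}) (\<lambda>_. borel))"

lemma space_others [simp]: "space (others i) = space M"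
  by (simp add: others_def)

lemma others_component:
  assumes "k \<noteq> Inr i"
  shows "(case k of Inl j \<Rightarrow> T j | Inr j \<Rightarrow> U j) \<in> borel_measurable (others i)"
proof -
  let ?V = "\<lambda>k. case k of Inl j \<Rightarrow> T j | Inr j \<Rightarrow> U j"
  let ?Y = "\<lambda>\<omega>. restrict (\<lambda>k. ?V k \<omega>) (UNIV - {Inr i})"
  have "?Y \<in> measurable (others i) (Pi\<^sub>M (UNIV - {Inr i}) (\<lambda>_. borel))"
    unfolding others_def by (intro measurable_vimage_algebra1) (auto simp: space_PiM)
  from measurable_compose[OF this measurable_component_singleton[of k]] assms
  show ?thesis by simp
qed

lemma T_others [measurable]: "T j \<in> borel_measurable (others i)"
  using others_component[of "Inl j" i] by simp

lemma U_others: "j \<noteq> i \<Longrightarrow> U j \<in> borel_measurable (others i)"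
  using others_component[of "Inr j" i] by simp

lemma sets_others_subset: "sets (others i) \<subseteq> sets M"
  and others_indep: "A \<in> sets (others i) \<Longrightarrow> B \<in> sets borel \<Longrightarrow>
    prob (A \<inter> (U i -` B \<inter> space M)) = prob A * prob (U i -` B \<inter> space M)"
proof -
  let ?V = "\<lambda>k. case k of Inl j \<Rightarrow> T j | Inr j \<Rightarrow> U j"
  let ?Y = "\<lambda>\<omega>. restrict (\<lambda>k. ?V k \<omega>) (UNIV - {Inr i})"
  let ?Z = "\<lambda>\<omega>. restrict (\<lambda>k. ?V k \<omega>) {Inr i}"
  let ?P = "Pi\<^sub>M (UNIV - {Inr i}) (\<lambda>_. borel) :: (nat + nat \<Rightarrow> real) measure"
  let ?Q = "Pi\<^sub>M {Inr i} (\<lambda>_. borel) :: (nat + nat \<Rightarrow> real) measure"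
  have Y: "?Y \<in> space M \<rightarrow> space ?P" by (auto simp: space_PiM)
  have indYZ: "indep_var ?P ?Y ?Q ?Z"
    by (rule indep_var_restrict[OF indep]) auto
  have A: "\<exists>A'\<in>sets ?P. A = ?Y -` A' \<inter> space M" if "A \<in> sets (others i)" for A
    using that unfolding others_def sets_vimage_algebra2[OF Y] by auto
  show "sets (others i) \<subseteq> sets M"
    using A measurable_sets[OF indep_var_rv1[OF indYZ]] by blast
  assume "A \<in> sets (others i)" and B: "B \<in> sets borel"
  with A obtain A' where A': "A' \<in> sets ?P" "A = ?Y -` A' \<inter> space M" by blast
  define B' where "B' = (\<lambda>f. f (Inr i)) -` B \<inter> space ?Q"
  have B': "B' \<in> sets ?Q" unfolding B'_def
    by (rule measurable_sets[OF measurable_component_singleton]) (use B in auto)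
  have ZB: "?Z -` B' \<inter> space M = U i -` B \<inter> space M"
    by (auto simp: B'_def space_PiM)
  have "A \<inter> (U i -` B \<inter> space M) = (\<lambda>\<omega>. (?Y \<omega>, ?Z \<omega>)) -` (A' \<times> B') \<inter> space M"
    unfolding A'(2) ZB[symmetric] by auto
  then have "prob (A \<inter> (U i -` B \<inter> space M)) = prob (?Y -` A' \<inter> space M) * prob (?Z -` B' \<inter> space M)"
    using indep_varD[OF indYZ A'(1) B'] by simp
  then show "prob (A \<inter> (U i -` B \<inter> space M)) = prob A * prob (U i -` B \<inter> space M)"
    unfolding A'(2) ZB .
qed

section \<open>Adjoining the null sets of the completion\<close>

lemma prob_space_completion: "prob_space (completion M)"
  by (rule prob_spaceI) (simp add: emeasure_space_1)

text \<open>The filtration contains all null sets of the completion, so what is known before an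
  arrival lies in this enlargement rather than in \<open>others i\<close> itself.\<close>

definition others_completed :: "nat \<Rightarrow> 'a measure" where
  "others_completed i = sigma (space M) (sets (others i) \<union> null_sets (completion M))"

lemma others_completed_generators:
  "sets (others i) \<union> null_sets (completion M) \<subseteq> Pow (space M)"
  using sets.sets_into_space[of _ "others i"] sets.sets_into_space[of _ "completion M"]
  by (auto dest!: null_setsD2)

lemma space_others_completed [simp]: "space (others_completed i) = space M"
  unfolding others_completed_def by (rule space_measure_of[OF others_completed_generators])

lemma sets_others_completed:
  "sets (others_completed i) = sigma_sets (space M) (sets (others i) \<union> null_sets (completion M))"
  unfolding others_completed_def using others_completed_generators by (rule sets_measure_of)

lemma others_in_completed: "A \<in> sets (others i) \<Longrightarrow> A \<in> sets (others_completed i)"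
  unfolding sets_others_completed by (rule sigma_sets.Basic) simp

lemma null_in_others_completed: "A \<in> null_sets (completion M) \<Longrightarrow> A \<in> sets (others_completed i)"
  unfolding sets_others_completed by (rule sigma_sets.Basic) simp

lemma others_completed_in_completion: "sets (others_completed i) \<subseteq> sets (completion M)"
proof -
  have "sigma_sets (space (completion M)) (sets (others i) \<union> null_sets (completion M)) \<subseteq> sets (completion M)"
    using sets_others_subset by (intro sets.sigma_sets_subset) (auto intro: sets_completionI_sets)
  then show ?thesis by (simp add: sets_others_completed)
qed

text \<open>Sets need to be compared on regular paths only, since every subset of
  \<open>irregular\<close> is null and thus belongs to the enlargement.\<close>

lemma others_completed_modify:
  assumes S: "S \<in> sets (others_completed i)" and "A \<subseteq> space M" and eq: "A - irregular = S - irregular"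
  shows "A \<in> sets (others_completed i)"
proof -
  have "A = (S - irregular) \<union> (A \<inter> irregular)" using eq by blast
  moreover have "irregular \<in> sets (others_completed i)" "A \<inter> irregular \<in> sets (others_completed i)"
    by (intro null_in_others_completed subset_irregular_null; simp)+
  ultimately show ?thesis using S by (metis sets.Diff sets.Un)
qed

text \<open>Almost everywhere agreement with a member of \<open>others i\<close> holds for the
  generators and is stable under complements and countable unions. Independence therefore carries
  over to the enlargement.\<close>

lemma others_completed_approx:
  assumes "A \<in> sets (others_completed i)"
  shows "\<exists>B\<in>sets (others i). AE \<omega> in completion M. \<omega> \<in> A \<longleftrightarrow> \<omega> \<in> B"
  using assms unfolding sets_others_completed
proof (induction rule: sigma_sets.induct)
  case (Basic A)
  then show ?case
  proof
    assume "A \<in> null_sets (completion M)"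
    then have "AE \<omega> in completion M. \<omega> \<notin> A" by (rule AE_not_in)
    then show ?thesis by (intro bexI[of _ "{}"]) auto
  qed auto
next
  case Empty
  then show ?case by (intro bexI[of _ "{}"]) auto
next
  case (Compl A)
  then obtain B where B: "B \<in> sets (others i)" "AE \<omega> in completion M. \<omega> \<in> A \<longleftrightarrow> \<omega> \<in> B" by blast
  have "space M - B \<in> sets (others i)" using sets.compl_sets[OF B(1)] by simp
  moreover have "AE \<omega> in completion M. \<omega> \<in> space M - A \<longleftrightarrow> \<omega> \<in> space M - B" using B(2) by auto
  ultimately show ?case by blast
next
  case (Union A)
  then obtain B where B: "\<And>k. B k \<in> sets (others i)" "\<And>k. AE \<omega> in completion M. \<omega> \<in> A k \<longleftrightarrow> \<omega> \<in> B k" by metis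
  from B(2) have "AE \<omega> in completion M. \<forall>k. \<omega> \<in> A k \<longleftrightarrow> \<omega> \<in> B k" by (simp add: AE_all_countable)
  then have "AE \<omega> in completion M. \<omega> \<in> (\<Union>k. A k) \<longleftrightarrow> \<omega> \<in> (\<Union>k. B k)" by auto
  moreover have "(\<Union>k. B k) \<in> sets (others i)" using B(1) by auto
  ultimately show ?case by blast
qed

lemma others_completed_indep:
  assumes A: "A \<in> sets (others_completed i)" and B: "B \<in> sets borel"
  shows "measure (completion M) (A \<inter> (U i -` B \<inter> space M))
    = measure (completion M) A * prob (U i -` B \<inter> space M)"
proof -
  let ?V = "U i -` B \<inter> space M"
  obtain A' where A': "A' \<in> sets (others i)" "AE \<omega> in completion M. \<omega> \<in> A \<longleftrightarrow> \<omega> \<in> A'"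
    using others_completed_approx[OF A] by blast
  have V: "?V \<in> sets M" by (rule measurable_sets) (use B in auto)
  have A'M: "A' \<in> sets M" using A'(1) sets_others_subset by blast
  have AM: "A \<in> sets (completion M)" using A others_completed_in_completion by blast
  have "measure (completion M) (A \<inter> ?V) = measure (completion M) (A' \<inter> ?V)"
    by (rule measure_eq_AE) (use A'(2) AM A'M V in \<open>auto intro: sets_completionI_sets\<close>)
  also have "\<dots> = prob A' * prob ?V"
    using A'M V others_indep[OF A'(1) B] by simp
  also have "prob A' = measure (completion M) A'" using A'M by simp
  also have "\<dots> = measure (completion M) A"
    by (rule measure_eq_AE) (use A'(2) AM A'M in \<open>auto intro: sets_completionI_sets\<close>)
  finally show ?thesis .
qed

lemma prob_U_interval_le:
  assumes "a \<le> b"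
  shows "prob (U i -` {a<..b} \<inter> space M) \<le> K * (b - a)"
proof -
  have "U i -` {a<..b} \<inter> space M = {\<omega> \<in> space M. U i \<omega> \<le> b} - {\<omega> \<in> space M. U i \<omega> \<le> a}" by auto
  moreover have "prob ({\<omega> \<in> space M. U i \<omega> \<le> b} - {\<omega> \<in> space M. U i \<omega> \<le> a}) = F b - F a"
    using assms by (subst finite_measure_Diff) (auto simp: U_distribution)
  ultimately show ?thesis using F_lipschitz[of b a] assms by simp
qed

text \<open>Both \<open>Y\<close> and \<open>U i\<close> are discretised with mesh \<open>e\<close>; by independence they fall into a common cell
  with probability at most \<open>K * e\<close>.\<close>

lemma AE_U_neq_others_completed:
  assumes Y: "Y \<in> borel_measurable (others_completed i)"
  shows "AE \<omega> in M. Y \<omega> \<noteq> U i \<omega>"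
proof -
  let ?P = "completion M"
  \<comment> \<open>Only positive claims are considered, because the cells below, indexed by natural
    numbers, cover the positive half-line; claims are positive almost surely.\<close>
  let ?E = "{\<omega> \<in> space M. Y \<omega> = U i \<omega> \<and> 0 < U i \<omega>}"
  have YM: "Y -` B \<inter> space M \<in> sets (others_completed i)" if "B \<in> sets borel" for B
    using measurable_sets[OF Y that] by simp
  have Y'[measurable]: "Y \<in> borel_measurable ?P"
    by (rule measurableI) (use YM others_completed_in_completion in auto)
  have U'[measurable]: "U i \<in> borel_measurable ?P"
    by (intro measurable_completion) measurable
  have sets_E: "?E \<in> sets ?P"
  proof -
    have "{\<omega> \<in> space ?P. Y \<omega> = U i \<omega> \<and> 0 < U i \<omega>} \<in> sets ?P" by measurable
    then show ?thesis by simp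
  qed
  have small: "emeasure ?P ?E \<le> ennreal \<delta>" if "0 < \<delta>" for \<delta>
  proof -
    \<comment> \<open>With this mesh the Lipschitz bound \<open>K * e\<close> for one cell equals
      \<delta>.\<close>
    define e where "e = \<delta> / K"
    have e: "0 < e" "K * e = \<delta>" using that K_pos by (auto simp: e_def)
    define I where "I k = {real k * e<..(real k + 1) * e}" for k :: nat
    have I_borel [measurable]: "I k \<in> sets borel" for k by (simp add: I_def)
    have cover: "\<exists>k. y \<in> I k" if "0 < y" for y
    proof -
      define k where "k = nat (\<lceil>y / e\<rceil> - 1)"
      have "0 < y / e" using that e by simp
      then have k: "real k = of_int \<lceil>y / e\<rceil> - 1" unfolding k_def by simp
      have "real k < y / e" "y / e \<le> real k + 1" unfolding k by linarith+
      then show ?thesis using e(1) unfolding I_def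
        by (intro exI[of _ k]) (simp add: pos_less_divide_eq pos_divide_le_eq)
    qed
    have disj: "disjoint_family I"
    proof (unfold disjoint_family_on_def, intro ballI impI)
      have "I k \<inter> I l = {}" if "k < l" for k l :: nat
      proof -
        have "(real k + 1) * e \<le> real l * e" using that e(1) by (intro mult_right_mono) auto
        then show ?thesis by (auto simp: I_def)
      qed
      then show "I k \<inter> I l = {}" if "k \<noteq> l" for k l using that
        by (cases k l rule: linorder_cases) (auto simp: Int_commute)
    qed
    let ?A = "\<lambda>k. Y -` I k \<inter> space M"
    let ?B = "\<lambda>k. U i -` I k \<inter> space M"
    have A: "?A k \<in> sets ?P" for k using YM[OF I_borel] others_completed_in_completion by blast
    have B: "?B k \<in> sets M" for k by measurable
    have AB: "?A k \<inter> ?B k \<in> sets ?P" for k using A B by (auto intro: sets_completionI_sets)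
    have "emeasure ?P ?E \<le> emeasure ?P (\<Union>k. ?A k \<inter> ?B k)"
    proof (rule emeasure_mono)
      show "?E \<subseteq> (\<Union>k. ?A k \<inter> ?B k)"
      proof
        fix \<omega> assume \<omega>: "\<omega> \<in> ?E"
        then obtain k where "U i \<omega> \<in> I k" using cover by blast
        with \<omega> show "\<omega> \<in> (\<Union>k. ?A k \<inter> ?B k)" by auto
      qed
      show "(\<Union>k. ?A k \<inter> ?B k) \<in> sets ?P" by (intro sets.countable_UN) (use AB in blast)
    qed
    also have "\<dots> \<le> (\<Sum>k. emeasure ?P (?A k \<inter> ?B k))"
      by (rule emeasure_subadditive_countably) (use AB in blast)
    \<comment> \<open>By independence each term is at most \<delta> times the probability that
      \<open>Y\<close> lies in the cell; the cells are disjoint, so these probabilities sum to at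
      most 1.\<close>
    also have "\<dots> \<le> (\<Sum>k. ennreal \<delta> * emeasure ?P (?A k))"
    proof (intro suminf_le summableI)
      fix k
      have "measure ?P (?A k \<inter> ?B k) \<le> measure ?P (?A k) * \<delta>"
        unfolding others_completed_indep[OF YM[OF I_borel] I_borel]
        using prob_U_interval_le[of "real k * e" "(real k + 1) * e" i] e
        by (intro mult_left_mono) (auto simp: I_def algebra_simps)
      then have "ennreal (measure ?P (?A k \<inter> ?B k)) \<le> ennreal (\<delta> * measure ?P (?A k))"
        by (intro ennreal_leI) (simp add: mult.commute)
      then show "emeasure ?P (?A k \<inter> ?B k) \<le> ennreal \<delta> * emeasure ?P (?A k)"
        using \<open>0 < \<delta>\<close>
        by (simp add: finite_measure.emeasure_eq_measure[OF prob_space.finite_measure[OF prob_space_completion]]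
            ennreal_mult del: emeasure_completion)
    qed
    also have "\<dots> = ennreal \<delta> * emeasure ?P (\<Union>k. ?A k)"
    proof -
      have "disjoint_family ?A" using disj unfolding disjoint_family_on_def by blast
      then have "(\<Sum>k. emeasure ?P (?A k)) = emeasure ?P (\<Union>k. ?A k)"
        using A by (intro suminf_emeasure) auto
      then show ?thesis by (simp only: ennreal_suminf_cmult)
    qed
    also have "\<dots> \<le> ennreal \<delta> * 1"
      by (intro mult_left_mono prob_space.emeasure_le_1 prob_space_completion) auto
    finally show ?thesis by simp
  qed
  have "emeasure ?P ?E \<le> 0"
    by (rule ennreal_le_epsilon) (use small in \<open>simp del: emeasure_completion\<close>)
  then have "?E \<in> null_sets ?P" using sets_E by (simp add: null_sets_def del: emeasure_completion)
  then have "AE \<omega> in ?P. \<omega> \<notin> ?E" by (rule AE_not_in)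
  then have "AE \<omega> in M. \<omega> \<notin> ?E" by (simp add: AE_completion_iff)
  moreover have "AE \<omega> in M. \<omega> \<in> space M" by (rule AE_space)
  ultimately show ?thesis
    using AE_regular_path
  proof eventually_elim
    case (elim \<omega>)
    then have "0 < U i \<omega>" unfolding regular_path_def by blast
    with elim(1,2) show ?case by simp
  qed
qed

section \<open>The completed filtration before an arrival\<close>

lemma arrival_others [measurable]: "arrival T j \<in> borel_measurable (others i)"
proof -
  have "(\<lambda>\<omega>. \<Sum>k\<le>j. T k \<omega>) \<in> borel_measurable (others i)" by measurable
  then show ?thesis by (simp add: arrival_def[abs_def])
qed

lemma before_arrival_set: "{\<omega> \<in> space M. t < arrival T i \<omega>} \<in> sets (others i)"
proof -
  have "{\<omega> \<in> space (others i). t < arrival T i \<omega>} \<in> sets (others i)" by measurable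
  then show ?thesis by simp
qed

lemma filt_generators:
  "{surplus p T U 0 s -` B \<inter> space M | s B. 0 \<le> s \<and> s \<le> t \<and> B \<in> sets borel} \<union> null_sets (completion M)
    \<subseteq> Pow (space M)"
  using others_completed_generators by auto

lemma space_filt [simp]: "space (filt M p T U t) = space M"
  unfolding filt_def by (rule space_measure_of[OF filt_generators])

lemma sets_filt: "sets (filt M p T U t) = sigma_sets (space M)
     ({surplus p T U 0 s -` B \<inter> space M | s B. 0 \<le> s \<and> s \<le> t \<and> B \<in> sets borel} \<union> null_sets (completion M))"
  unfolding filt_def using filt_generators by (rule sets_measure_of)

lemma null_in_filt: "A \<in> null_sets (completion M) \<Longrightarrow> A \<in> sets (filt M p T U t)"
  unfolding sets_filt by (rule sigma_sets.Basic) simp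

lemma surplus_filt: "0 \<le> t \<Longrightarrow> surplus p T U x t \<in> borel_measurable (filt M p T U t)"
proof -
  assume "0 \<le> t"
  then have "surplus p T U 0 t \<in> borel_measurable (filt M p T U t)"
    by (intro measurableI) (auto simp: sets_filt intro!: sigma_sets.Basic)
  then have "(\<lambda>\<omega>. x + surplus p T U 0 t \<omega>) \<in> borel_measurable (filt M p T U t)" by measurable
  then show ?thesis by (simp add: surplus_def[abs_def] algebra_simps)
qed

text \<open>Before the \<open>i\<close>-th arrival, the past does not involve the claim \<open>U i\<close>.\<close>

lemma filt_trace:
  assumes "A \<in> sets (filt M p T U t)"
  shows "A \<inter> {\<omega> \<in> space M. t < arrival T i \<omega>} \<in> sets (others_completed i)"
  using assms unfolding sets_filt
proof (induction rule: sigma_sets.induct)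
  case (Basic A)
  let ?E = "{\<omega> \<in> space M. t < arrival T i \<omega>}"
  have E: "?E \<in> sets (others_completed i)" by (intro others_in_completed before_arrival_set)
  from Basic show ?case
  proof
    assume "A \<in> null_sets (completion M)"
    then show ?thesis using E null_in_others_completed by (intro sets.Int) auto
  next
    assume "A \<in> {surplus p T U 0 s -` B \<inter> space M | s B. 0 \<le> s \<and> s \<le> t \<and> B \<in> sets borel}"
    then obtain s B where sB: "A = surplus p T U 0 s -` B \<inter> space M" "s \<le> t" and B [measurable]: "B \<in> sets borel"
      by blast
    \<comment> \<open>Before arrival \<open>i\<close> only claims with smaller index have occurred,
      so on regular paths the surplus equals \<open>R\<close>, in which \<open>U i\<close> does not
      appear.\<close>
    define R where "R \<omega> = p * s - (\<Sum>j<i. if arrival T j \<omega> \<le> s then U j \<omega> else 0)" for \<omega>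
    have [measurable]: "R \<in> borel_measurable (others i)"
    proof -
      have "(\<lambda>\<omega>. if arrival T j \<omega> \<le> s then U j \<omega> else 0) \<in> borel_measurable (others i)" if "j < i" for j
      proof -
        have [measurable]: "U j \<in> borel_measurable (others i)" using that by (intro U_others) simp
        show ?thesis by measurable
      qed
      then show ?thesis unfolding R_def[abs_def] by (intro borel_measurable_diff borel_measurable_sum) auto
    qed
    have R_eq: "surplus p T U 0 s \<omega> = R \<omega>" if "\<omega> \<in> ?E" "\<omega> \<notin> irregular" for \<omega>
    proof -
      have reg: "regular_path T U \<omega>" using that by (auto simp: irregular_def)
      have "{j. arrival T j \<omega> \<le> s} \<subseteq> {..<i}"
        using arrivals_before_subset[OF reg] that(1) sB(2) by simp
      then have "(\<Sum>j\<in>{j. arrival T j \<omega> \<le> s}. U j \<omega>) = (\<Sum>j\<in>{..<i} \<inter> {j. arrival T j \<omega> \<le> s}. U j \<omega>)"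
        by (simp only: Int_absorb1)
      also have "\<dots> = (\<Sum>j<i. if arrival T j \<omega> \<le> s then U j \<omega> else 0)"
        by (subst sum.inter_restrict) simp_all
      finally show ?thesis by (simp add: surplus_def R_def)
    qed
    have "R -` B \<inter> space (others i) \<inter> ?E \<in> sets (others i)"
      by (intro sets.Int before_arrival_set measurable_sets[of R _ borel]) measurable
    then show ?thesis
      unfolding sB(1)
      by (rule others_completed_modify[OF others_in_completed]) (use R_eq in auto)
  qed
next
  case Empty
  then show ?case by simp
next
  case (Compl A)
  have "(space M - A) \<inter> {\<omega> \<in> space M. t < arrival T i \<omega>}
     = {\<omega> \<in> space M. t < arrival T i \<omega>} - A \<inter> {\<omega> \<in> space M. t < arrival T i \<omega>}" by auto
  with Compl.IH show ?case by (simp add: others_in_completed[OF before_arrival_set] sets.Diff)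
next
  case (Union A)
  have "(\<Union>k. A k) \<inter> {\<omega> \<in> space M. t < arrival T i \<omega>}
     = (\<Union>k. A k \<inter> {\<omega> \<in> space M. t < arrival T i \<omega>})" by blast
  moreover have "\<dots> \<in> sets (others_completed i)" using Union.IH by (intro sets.countable_UN) blast
  ultimately show ?case by simp
qed

text \<open>On regular paths the events \<open>t < arrival T i \<omega>\<close> exhaust the space as
  \<open>i\<close> varies, so a set of the filtration is the countable union of its traces up to a
  part of the irregular null set.\<close>

lemma filt_in_completion: "sets (filt M p T U t) \<subseteq> sets (completion M)"
proof
  fix A assume A: "A \<in> sets (filt M p T U t)"
  then have AM: "A \<subseteq> space M" using sets.sets_into_space by fastforce
  let ?S = "\<Union>i. A \<inter> {\<omega> \<in> space M. t < arrival T i \<omega>}"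
  have "?S \<in> sets (completion M)"
    using subsetD[OF others_completed_in_completion filt_trace[OF A]] by (intro sets.countable_UN) blast
  moreover have "A \<inter> irregular \<in> sets (completion M)"
    using subset_irregular_null[of "A \<inter> irregular"] by auto
  ultimately have "?S \<union> (A \<inter> irregular) \<in> sets (completion M)" by (rule sets.Un)
  moreover have "?S \<union> (A \<inter> irregular) = A"
  proof (intro equalityI subsetI)
    fix \<omega> assume "\<omega> \<in> A"
    moreover have "\<exists>i. t < arrival T i \<omega>" if "\<omega> \<notin> irregular"
    proof -
      have "regular_path T U \<omega>" using that \<open>\<omega> \<in> A\<close> AM unfolding irregular_def by blast
      then show ?thesis unfolding regular_path_def by blast
    qed
    ultimately show "\<omega> \<in> ?S \<union> (A \<inter> irregular)" using AM by blast
  qed blast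
  ultimately show "A \<in> sets (completion M)" by (rule back_subst)
qed

lemma filt_measurable_completion:
  "f \<in> borel_measurable (filt M p T U t) \<Longrightarrow> f \<in> borel_measurable (completion M)"
  using filt_in_completion by (auto simp: measurable_def)

lemma admissibleD:
  assumes "C \<in> admissible M p T U cbar x c"
  shows admissible_filt: "0 \<le> t \<Longrightarrow> C t \<in> borel_measurable (filt M p T U t)"
    and admissible_mono: "\<omega> \<in> space M \<Longrightarrow> mono_on {0..} (\<lambda>s. C s \<omega>)"
    and admissible_bounds: "\<omega> \<in> space M \<Longrightarrow> 0 \<le> t \<Longrightarrow> c \<le> C t \<omega> \<and> C t \<omega> \<le> cbar"
    and admissible_right_continuous: "\<omega> \<in> space M \<Longrightarrow> 0 \<le> t \<Longrightarrow> continuous (at_right t) (\<lambda>s. C s \<omega>)"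
  using assms unfolding admissible_def by blast+

text \<open>The surplus vanishes at the arrival exactly when its value just before, \<open>Y\<close>
  in the proof, equals \<open>U i\<close>. That value involves the rate only before the arrival,
  hence not the claim itself.\<close>

lemma AE_ctrl_surplus_arrival_nonzero:
  assumes C: "C \<in> admissible M p T U cbar x c" and "0 \<le> c"
  shows "AE \<omega> in M. ctrl_surplus p T U x C (arrival T i \<omega>) \<omega> \<noteq> 0"
proof -
  let ?N = "others_completed i"
  have sub: "f \<in> borel_measurable ?N" if "f \<in> borel_measurable (others i)" for f :: "'a \<Rightarrow> real"
  proof (rule measurableI)
    fix B :: "real set" assume "B \<in> sets borel"
    from others_in_completed[OF measurable_sets[OF that this]]
    show "f -` B \<inter> space ?N \<in> sets ?N" by simp
  qed simp
  have I: "(\<lambda>\<omega>. integral {0..arrival T i \<omega>} (\<lambda>s. C s \<omega>)) \<in> borel_measurable ?N"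
  proof (rule rate_integral_measurable[where b = cbar])
    show "arrival T i \<in> borel_measurable ?N" by (intro sub arrival_others)
    fix t :: real assume t: "0 \<le> t"
    let ?E = "{\<omega> \<in> space M. t < arrival T i \<omega>}"
    show "(\<lambda>\<omega>. if t < arrival T i \<omega> then C t \<omega> else 0) \<in> borel_measurable ?N"
    proof (rule measurableI)
      fix B :: "real set" assume B: "B \<in> sets borel"
      have E: "?E \<in> sets ?N" by (intro others_in_completed before_arrival_set)
      have "C t -` B \<inter> space M \<in> sets (filt M p T U t)"
        using measurable_sets[OF admissible_filt[OF C t] B] by simp
      from filt_trace[OF this, of i]
      have 1: "(C t -` B \<inter> space M) \<inter> ?E \<in> sets ?N" .
      \<comment> \<open>Off the event the function is 0, so the preimage of \<open>B\<close>
        contains the whole complement exactly if 0 lies in \<open>B\<close>.\<close>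
      have 2: "(if 0 \<in> B then space M - ?E else {}) \<in> sets ?N"
        using sets.compl_sets[OF E] by auto
      have "(\<lambda>\<omega>. if t < arrival T i \<omega> then C t \<omega> else 0) -` B \<inter> space ?N
        = (C t -` B \<inter> space M) \<inter> ?E \<union> (if 0 \<in> B then space M - ?E else {})"
        by (auto split: if_splits)
      also have "\<dots> \<in> sets ?N" using 1 2 by (rule sets.Un)
      finally show "(\<lambda>\<omega>. if t < arrival T i \<omega> then C t \<omega> else 0) -` B \<inter> space ?N \<in> sets ?N" .
    qed simp
  qed (use admissibleD[OF C] \<open>0 \<le> c\<close> in \<open>auto intro: order_trans\<close>)
  define Y where "Y \<omega> = x + p * arrival T i \<omega> - (\<Sum>j<i. U j \<omega>)
    - integral {0..arrival T i \<omega>} (\<lambda>s. C s \<omega>)" for \<omega>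
  have "Y \<in> borel_measurable ?N"
    unfolding Y_def[abs_def]
    by (intro borel_measurable_diff borel_measurable_add borel_measurable_times borel_measurable_sum
        borel_measurable_const I sub arrival_others U_others) simp
  from AE_U_neq_others_completed[OF this] AE_regular_path show ?thesis
  proof eventually_elim
    case (elim \<omega>)
    have "{j. arrival T j \<omega> \<le> arrival T i \<omega>} = insert i {..<i}"
      using strict_mono_less_eq[OF arrival_strict_mono[OF elim(2)]] by auto
    then have "ctrl_surplus p T U x C (arrival T i \<omega>) \<omega> = Y \<omega> - U i \<omega>"
      by (simp add: ctrl_surplus_def surplus_def Y_def)
    with elim(1) show ?case by simp
  qed
qed

lemma ctrl_surplus_measurable:
  assumes C: "C \<in> admissible M p T U cbar x c" and "0 \<le> c" and "0 \<le> t"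
  shows "ctrl_surplus p T U x C t \<in> borel_measurable (completion M)"
proof -
  have [measurable]: "(\<lambda>\<omega>. integral {0..t} (\<lambda>s. C s \<omega>)) \<in> borel_measurable (completion M)"
  proof (rule rate_integral_measurable[where b = cbar])
    fix s :: real assume "0 \<le> s"
    have "C s \<in> borel_measurable (completion M)"
      by (rule filt_measurable_completion) (rule admissible_filt[OF C \<open>0 \<le> s\<close>])
    then show "(\<lambda>\<omega>. if s < t then C s \<omega> else 0) \<in> borel_measurable (completion M)"
      by (cases "s < t") auto
  qed (use admissibleD[OF C] \<open>0 \<le> c\<close> in \<open>auto intro: order_trans\<close>)
  have [measurable]: "surplus p T U x t \<in> borel_measurable (completion M)"
    by (rule filt_measurable_completion[OF surplus_filt[OF \<open>0 \<le> t\<close>]])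
  show ?thesis unfolding ctrl_surplus_def[abs_def] by measurable
qed

section \<open>Convergence of the expected payoffs\<close>

definition payoff_density :: "real \<Rightarrow> (real \<Rightarrow> 'a \<Rightarrow> real) \<Rightarrow> 'a \<Rightarrow> real \<Rightarrow> ennreal" where
  "payoff_density x C \<omega> s =
    ennreal (indicator {s. 0 \<le> s \<and> ereal s < ruin_time p T U x C \<omega>} s * exp (- q * s) * C s \<omega>)"

definition payoff :: "real \<Rightarrow> (real \<Rightarrow> 'a \<Rightarrow> real) \<Rightarrow> 'a \<Rightarrow> ennreal" where
  "payoff x C \<omega> = (\<integral>\<^sup>+ s. payoff_density x C \<omega> s \<partial>lborel)"

lemma Jval_eq: "Jval M p T U q x C = enn2real (\<integral>\<^sup>+ \<omega>. payoff x C \<omega> \<partial>completion M)"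
  by (simp add: Jval_def payoff_def payoff_density_def)

lemma payoff_density_measurable:
  assumes C: "C \<in> admissible M p T U cbar x c" and "0 \<le> c" and \<omega>: "\<omega> \<in> space M"
  shows "payoff_density x C \<omega> \<in> borel_measurable lborel"
proof -
  have "mono (\<lambda>s. if 0 \<le> s then C s \<omega> else 0)"
  proof (rule monoI)
    fix s t :: real assume "s \<le> t"
    then show "(if 0 \<le> s then C s \<omega> else 0) \<le> (if 0 \<le> t then C t \<omega> else 0)"
      using mono_onD[OF admissible_mono[OF C \<omega>], of s t] admissible_bounds[OF C \<omega>, of t] \<open>0 \<le> c\<close>
      by auto
  qed
  then have [measurable]: "(\<lambda>s. if 0 \<le> s then C s \<omega> else 0) \<in> borel_measurable borel"
    by (rule borel_measurable_mono)
  have "payoff_density x C \<omega> = (\<lambda>s. ennreal (if ereal s < ruin_time p T U x C \<omega>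
      then exp (- q * s) * (if 0 \<le> s then C s \<omega> else 0) else 0))"
    by (auto simp: payoff_density_def fun_eq_iff)
  also have "\<dots> \<in> borel_measurable lborel" by measurable
  finally show ?thesis .
qed

lemma payoff_le:
  assumes C: "C \<in> admissible M p T U cbar x c" and \<omega>: "\<omega> \<in> space M"
  shows "payoff x C \<omega> \<le> ennreal (cbar / q)"
proof -
  \<comment> \<open>The discount factor is the exponential density with parameter \<open>q\<close>
    divided by \<open>q\<close>, so the bound integrates to \<open>cbar / q\<close>.\<close>
  have "payoff x C \<omega> \<le> (\<integral>\<^sup>+ s. ennreal (cbar / q) * ennreal (exponential_density q s) \<partial>lborel)"
    unfolding payoff_def
  proof (rule nn_integral_mono)
    fix s
    have "indicator {s. 0 \<le> s \<and> ereal s < ruin_time p T U x C \<omega>} s * exp (- q * s) * C s \<omega>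
        \<le> cbar / q * exponential_density q s"
      using admissible_bounds[OF C \<omega>, of s] cbar_pos discount_pos
      by (auto simp: exponential_density_def indicator_def mult.commute)
    then show "payoff_density x C \<omega> s \<le> ennreal (cbar / q) * ennreal (exponential_density q s)"
      using cbar_pos discount_pos unfolding payoff_density_def
      by (subst ennreal_mult'[symmetric]) (auto intro: ennreal_leI)
  qed
  also have "\<dots> = ennreal (cbar / q) * (\<integral>\<^sup>+ s. ennreal (exponential_density q s) \<partial>lborel)"
    by (rule nn_integral_cmult) measurable
  also have "(\<integral>\<^sup>+ s. ennreal (exponential_density q s) \<partial>lborel) = 1"
    using prob_space.emeasure_space_1[OF prob_space_exponential_density[OF discount_pos]]
    by (simp add: emeasure_density)
  finally show ?thesis by simp
qed

lemma expected_payoff_le: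
  assumes C: "C \<in> admissible M p T U cbar x c"
  shows "(\<integral>\<^sup>+ \<omega>. payoff x C \<omega> \<partial>completion M) \<le> ennreal (cbar / q)"
proof -
  have "(\<integral>\<^sup>+ \<omega>. payoff x C \<omega> \<partial>completion M) \<le> (\<integral>\<^sup>+ \<omega>. ennreal (cbar / q) \<partial>completion M)"
    by (rule nn_integral_mono) (use payoff_le[OF C] in simp)
  also have "\<dots> = ennreal (cbar / q)"
    using prob_space.emeasure_space_1[OF prob_space_completion] by (simp del: emeasure_completion)
  finally show ?thesis .
qed

text \<open>Ruin can be detected at rational times, since the controlled surplus grows at most at rate \<open>p\<close>.\<close>

lemma negative_at_rational:
  assumes reg: "regular_path T U \<omega>" and C: "mono_on {0..} (\<lambda>s. C s \<omega>)" and nn: "0 \<le> C r \<omega>"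
    and "0 \<le> r" "r < s" and neg: "ctrl_surplus p T U x C r \<omega> < 0"
  shows "\<exists>u::rat. 0 \<le> real_of_rat u \<and> real_of_rat u \<le> s \<and> ctrl_surplus p T U x C (real_of_rat u) \<omega> < 0"
proof -
  let ?X = "\<lambda>t. ctrl_surplus p T U x C t \<omega>"
  \<comment> \<open>Premiums alone need the time \<open>- ?X r / p\<close> to lift the surplus back
    to zero, so it stays negative from \<open>r\<close> up to, but excluding,
    \<open>s'\<close>.\<close>
  define s' where "s' = min s (r - ?X r / p)"
  have "r < s'" using assms premium_pos by (simp add: s'_def divide_neg_pos)
  then obtain u where u: "r < real_of_rat u" "real_of_rat u < s'" using of_rat_dense by blast
  have "?X (real_of_rat u) \<le> ?X r + p * (real_of_rat u - r)"
    using ctrl_surplus_le[where C=C and \<omega>=\<omega> and m=0 and p=p and x=x, OF reg C \<open>0 \<le> r\<close> less_imp_le[OF u(1)] nn]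
    by simp
  also have "\<dots> < ?X r + p * (- ?X r / p)"
    using u(2) premium_pos by (intro add_strict_left_mono mult_strict_left_mono) (auto simp: s'_def)
  finally have "?X (real_of_rat u) < 0" using premium_pos by simp
  moreover have "0 \<le> real_of_rat u" "real_of_rat u \<le> s" using u \<open>0 \<le> r\<close> by (simp_all only: s'_def min_less_iff_conj) linarith+
  ultimately show ?thesis by (intro exI[of _ u]) simp
qed

text \<open>The ruin time is an infimum over uncountably many times. Testing the sign of the surplus
  at rational times instead gives a jointly measurable integrand, which on regular paths differs
  from the payoff density at most at the ruin time itself.\<close>

lemma payoff_AE_eq_measurable:
  assumes C: "C \<in> admissible M p T U cbar x c" and "0 \<le> c"
  obtains h where "h \<in> borel_measurable (completion M)"
    and "AE \<omega> in completion M. payoff x C \<omega> = h \<omega>"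
proof
  let ?ok = "\<lambda>\<omega> s. \<forall>u::rat. 0 \<le> real_of_rat u \<longrightarrow> real_of_rat u \<le> s \<longrightarrow>
    0 \<le> ctrl_surplus p T U x C (real_of_rat u) \<omega>"
  let ?g = "\<lambda>\<omega> s. ennreal (if ?ok \<omega> s then exp (- q * s) * (if 0 \<le> s then C s \<omega> else 0) else 0)"
  let ?N = "completion M \<Otimes>\<^sub>M lborel"
  have [measurable]: "(\<lambda>(\<omega>, s). if 0 \<le> s then C s \<omega> else 0) \<in> borel_measurable ?N"
  proof (rule right_continuous_jointly_measurable)
    show "C t \<in> borel_measurable (completion M)" if "0 \<le> t" for t
      by (rule filt_measurable_completion[OF admissible_filt[OF C that]])
  qed (use admissible_right_continuous[OF C] in simp)
  have ok: "Measurable.pred ?N (\<lambda>z. ?ok (fst z) (snd z))"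
  proof (rule pred_intros_countable)
    fix u :: rat
    show "Measurable.pred ?N (\<lambda>z. 0 \<le> real_of_rat u \<longrightarrow> real_of_rat u \<le> snd z \<longrightarrow>
        0 \<le> ctrl_surplus p T U x C (real_of_rat u) (fst z))"
    proof (cases "0 \<le> real_of_rat u")
      case True
      have [measurable]: "ctrl_surplus p T U x C (real_of_rat u) \<in> borel_measurable (completion M)"
        by (rule ctrl_surplus_measurable[OF C \<open>0 \<le> c\<close> True])
      show ?thesis by measurable
    qed simp
  qed
  have "(\<lambda>z. ennreal (if ?ok (fst z) (snd z)
      then exp (- q * snd z) * (case z of (\<omega>, s) \<Rightarrow> if 0 \<le> s then C s \<omega> else 0) else 0)) \<in> borel_measurable ?N"
    using ok by measurable
  then have "(\<lambda>(\<omega>, s). ?g \<omega> s) \<in> borel_measurable ?N"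
    by (simp only: case_prod_beta')
  from lborel.borel_measurable_nn_integral[OF this]
  show "(\<lambda>\<omega>. \<integral>\<^sup>+ s. ?g \<omega> s \<partial>lborel) \<in> borel_measurable (completion M)" .
  have "AE \<omega> in M. payoff x C \<omega> = (\<integral>\<^sup>+ s. ?g \<omega> s \<partial>lborel)"
    using AE_regular_path AE_space
  proof eventually_elim
    case (elim \<omega>)
    note mono = admissible_mono[OF C elim(2)] and bd = admissible_bounds[OF C elim(2)]
    let ?r = "ruin_time p T U x C \<omega>"
    have before: "?ok \<omega> s" if "ereal s < ?r" for s
      using that by (intro allI impI ctrl_surplus_nonneg_before_ruin)
        (auto intro: le_less_trans[of "ereal _" "ereal s"])
    have after: "\<not> ?ok \<omega> s" if s: "?r < ereal s" for s
    proof -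
      obtain t where t: "0 \<le> t" "ctrl_surplus p T U x C t \<omega> < 0" "t < s"
        using s unfolding ruin_time_def Inf_less_iff by auto
      show ?thesis
        using negative_at_rational[where C=C and \<omega>=\<omega> and x=x, OF elim(1) mono _ t(1,3,2)] bd[OF t(1)] \<open>0 \<le> c\<close>
        by (auto simp: not_le)
    qed
    \<comment> \<open>If the ruin time is infinite, \<open>real_of_ereal\<close> returns 0 and a
      harmless point is removed.\<close>
    have "AE s in lborel. s \<noteq> real_of_ereal ?r" by (rule AE_lborel_singleton)
    then have "AE s in lborel. payoff_density x C \<omega> s = ?g \<omega> s"
    proof eventually_elim
      case (elim s)
      then have "ereal s \<noteq> ?r" by (metis real_of_ereal.simps(1))
      then consider "ereal s < ?r" | "?r < ereal s" by fastforce
      then show ?case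
      proof cases
        case 1
        with before[OF 1] show ?thesis by (simp add: payoff_density_def)
      next
        case 2
        then have "\<not> ereal s < ?r" by (rule less_not_sym)
        then have "payoff_density x C \<omega> s = 0" by (simp add: payoff_density_def)
        then show ?thesis unfolding if_not_P[OF after[OF 2]] by simp
      qed
    qed
    then show ?case unfolding payoff_def by (rule nn_integral_cong_AE)
  qed
  then show "AE \<omega> in completion M. payoff x C \<omega> = (\<integral>\<^sup>+ s. ?g \<omega> s \<partial>lborel)"
    by (rule AE_completion)
qed

text \<open>On the irregular null set the strategy is frozen, so that the convention on the rate \<open>p\<close> holds
  on every path.\<close>

definition round_strategy :: "real \<Rightarrow> (real \<Rightarrow> 'a \<Rightarrow> real) \<Rightarrow> nat \<Rightarrow> real \<Rightarrow> 'a \<Rightarrow> real" where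
  "round_strategy c C n t \<omega> = round_rate (grid p cbar n) c (if \<omega> \<in> irregular then c else C t \<omega>)"

lemma round_strategy_bounds:
  assumes c: "0 \<le> c" "c \<le> cbar"
  shows "round_strategy c C n t \<omega> \<in> grid p cbar n"
    and "c \<le> round_strategy c C n t \<omega>" and "round_strategy c C n t \<omega> \<le> cbar"
proof -
  have ex: "\<exists>g\<in>grid p cbar n. c \<le> g" using c grid_cbar by blast
  show "round_strategy c C n t \<omega> \<in> grid p cbar n"
    unfolding round_strategy_def by (rule round_rate_in[OF finite_grid ex])
  then show "round_strategy c C n t \<omega> \<le> cbar" by (rule grid_bounds(2)[OF cbar_pos premium_pos])
  show "c \<le> round_strategy c C n t \<omega>"
    unfolding round_strategy_def by (rule round_rate_ge[OF finite_grid ex])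
qed

lemma round_strategy_mono:
  assumes C: "C \<in> admissible M p T U cbar x c" and c: "0 \<le> c" "c \<le> cbar" and \<omega>: "\<omega> \<in> space M"
  shows "mono_on {0..} (\<lambda>s. round_strategy c C n s \<omega>)"
proof -
  have ex: "\<exists>g\<in>grid p cbar n. c \<le> g" using c grid_cbar by blast
  show ?thesis
    unfolding round_strategy_def
    by (intro mono_onI monoD[OF round_rate_mono[OF finite_grid ex]])
      (auto intro: mono_onD[OF admissible_mono[OF C \<omega>]])
qed

text \<open>The rounding is monotone, hence Borel, and the set where the strategy is frozen is null,
  hence in the filtration at every time; this keeps adaptedness. The convention follows from
  \<open>rate_stays_at_premium\<close> on regular paths and from constancy on frozen ones.\<close>

lemma round_strategy_admissible:
  assumes C: "C \<in> admissible M p T U cbar x c" and c: "0 \<le> c" "c \<le> cbar"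
  shows "round_strategy c C n \<in> admissible M p T U cbar x c"
proof -
  let ?D = "round_strategy c C n"
  let ?R = "round_rate (grid p cbar n) c"
  have ex: "\<exists>g\<in>grid p cbar n. c \<le> g" using c grid_cbar by blast
  show ?thesis
    unfolding admissible_def
  proof (intro CollectI conjI allI ballI impI)
    fix t :: real assume t: "0 \<le> t"
    have "irregular \<inter> space (filt M p T U t) \<in> sets (filt M p T U t)"
      by (intro sets.Int null_in_filt irregular_null sets.top)
    then have "(\<lambda>\<omega>. if \<omega> \<in> irregular then c else C t \<omega>) \<in> borel_measurable (filt M p T U t)"
      by (intro measurable_If_set measurable_const admissible_filt[OF C t]) auto
    from measurable_compose[OF this borel_measurable_mono[OF round_rate_mono[OF finite_grid ex]]]
    show "?D t \<in> borel_measurable (filt M p T U t)"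
      by (simp add: round_strategy_def[abs_def])
  next
    fix \<omega> assume \<omega>: "\<omega> \<in> space M"
    note D_mono = round_strategy_mono[OF C c \<omega>, of n]
    show "mono_on {0..} (\<lambda>s. ?D s \<omega>)" by (rule D_mono)
    fix t :: real
    show "c \<le> ?D t \<omega>" "?D t \<omega> \<le> cbar" by (rule round_strategy_bounds[OF c])+
    show "continuous (at_right t) (\<lambda>s. ?D s \<omega>)" if t: "0 \<le> t"
    proof (cases "\<omega> \<in> irregular")
      case True
      then show ?thesis by (simp add: round_strategy_def)
    next
      case False
      then show ?thesis
        using round_rate_right_continuous[OF finite_grid admissible_mono[OF C \<omega>] t admissible_right_continuous[OF C \<omega> t]]
        by (simp add: round_strategy_def)
    qed
    show "\<exists>l. ((\<lambda>s. ?D s \<omega>) \<longlongrightarrow> l) (at_left t)" if "0 < t"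
      by (rule mono_on_left_limit[OF D_mono that])
    fix s
    assume t: "0 \<le> t"
      and hit: "(0 < t \<and> Lim (at_left t) (\<lambda>s. ?D s \<omega>) = p \<or> t = 0 \<and> c = p) \<and> ctrl_surplus p T U x ?D t \<omega> = 0"
      and s: "t \<le> s" "ereal s < ruin_time p T U x ?D \<omega>"
    show "?D s \<omega> = p"
    proof (cases "\<omega> \<in> irregular")
      case True
      then have const: "?D s \<omega> = ?R c" for s by (simp add: round_strategy_def)
      \<comment> \<open>A frozen rate equals its left limit. In the case \<open>c = p\<close>, the
        premium is at most \<open>cbar\<close>, hence a grid point fixed by the rounding.\<close>
      have "?R c = p"
      proof (cases "c = p")
        case True
        have "?R p \<le> p" "p \<le> ?R p"
          using c True round_rate_grid_premium[of cbar p p p n] round_rate_ge[OF finite_grid ex, of p]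
          by (auto simp: cbar_pos premium_pos)
        with True show ?thesis by simp
      next
        case False
        with hit have "0 < t" "Lim (at_left t) (\<lambda>s. ?R c) = p" by (auto simp: const)
        moreover have "Lim (at_left t) (\<lambda>s. ?R c) = ?R c" by (rule tendsto_Lim) auto
        ultimately show ?thesis by simp
      qed
      then show ?thesis by (simp add: const)
    next
      case False
      then have reg: "regular_path T U \<omega>" using \<omega> by (simp add: irregular_def)
      \<comment> \<open>For \<open>0 < t\<close> the left limit \<open>p\<close> is at most the rate
        at \<open>t\<close>; at time 0 the rate is at least \<open>c = p\<close>.\<close>
      have "p \<le> ?D t \<omega>"
        using hit left_limit_le[OF D_mono, of t] round_strategy_bounds(2)[OF c, of C n t \<omega>] by auto
      from rate_stays_at_premium[where C="?D" and \<omega>=\<omega>, OF reg D_mono t this _ s] hit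
      show ?thesis by blast
    qed
  qed
qed

lemma round_strategy_close:
  assumes C: "C \<in> admissible M p T U cbar x c" and "0 \<le> c"
    and reg: "regular_path T U \<omega>" and \<omega>: "\<omega> \<in> space M" and t: "0 \<le> t"
  shows "\<bar>round_strategy c C n t \<omega> - C t \<omega>\<bar> \<le> cbar / 2 ^ n"
    and "C t \<omega> \<le> p \<Longrightarrow> round_strategy c C n t \<omega> \<le> p"
proof -
  have "\<omega> \<notin> irregular" using reg by (simp add: irregular_def)
  moreover have "c \<le> C t \<omega>" "C t \<omega> \<le> cbar" using admissible_bounds[OF C \<omega> t] by auto
  ultimately show "\<bar>round_strategy c C n t \<omega> - C t \<omega>\<bar> \<le> cbar / 2 ^ n"
    and "C t \<omega> \<le> p \<Longrightarrow> round_strategy c C n t \<omega> \<le> p"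
    using round_rate_grid[OF cbar_pos premium_pos \<open>0 \<le> c\<close>, of "C t \<omega>" n] by (simp_all add: round_strategy_def)
qed

lemma mesh_tendsto_0: "(\<lambda>n. cbar / 2 ^ n) \<longlonglongrightarrow> 0"
  using LIMSEQ_divide_realpow_zero[of 2 cbar] by simp

text \<open>Before the ruin of \<open>C\<close> the rounded strategies eventually survive and their
  rates converge; from then on the left density is zero. Rounded strategies may outlive
  \<open>C\<close>, hence only an inequality, and Fatou's lemma in the time variable
  finishes.\<close>

lemma payoff_le_liminf:
  assumes C: "C \<in> admissible M p T U cbar x c" and c: "0 \<le> c" "c \<le> cbar" and "0 \<le> x"
    and reg: "regular_path T U \<omega>" and \<omega>: "\<omega> \<in> space M"
    and nz: "\<And>i. ctrl_surplus p T U x C (arrival T i \<omega>) \<omega> \<noteq> 0"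
  shows "payoff x C \<omega> \<le> liminf (\<lambda>n. payoff x (round_strategy c C n) \<omega>)"
proof -
  let ?D = "round_strategy c C"
  note close = round_strategy_close[OF C c(1) reg \<omega>]
  have "payoff_density x C \<omega> s \<le> liminf (\<lambda>n. payoff_density x (?D n) \<omega> s)" for s
  proof (cases "0 \<le> s \<and> ereal s < ruin_time p T U x C \<omega>")
    case True
    have "eventually (\<lambda>n. ereal s < ruin_time p T U x (?D n) \<omega>) sequentially"
    proof (rule ruin_time_eventually_later[where C=C and D="?D" and \<omega>=\<omega> and d="\<lambda>n. cbar / 2 ^ n" and p=p and x=x and s=s,
          OF reg admissible_mono[OF C \<omega>] round_strategy_mono[OF C c \<omega>] _ _ mesh_tendsto_0 _ nz \<open>0 \<le> x\<close>])
      show "?D n s \<omega> \<le> C s \<omega> + cbar / 2 ^ n" if "0 \<le> s" for n s using close(1)[OF that, of n] by linarith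
      show "?D n s \<omega> \<le> p" if "0 \<le> s" "C s \<omega> \<le> p" for n s using close(2)[OF that] .
    qed (use True cbar_pos in auto)
    then have ev: "eventually (\<lambda>n. ennreal (exp (- q * s) * ?D n s \<omega>) = payoff_density x (?D n) \<omega> s) sequentially"
      by eventually_elim (use True in \<open>simp add: payoff_density_def\<close>)
    have "(\<lambda>n. ?D n s \<omega> - C s \<omega>) \<longlonglongrightarrow> 0"
      using close(1)[of s] True by (intro Lim_null_comparison[OF _ mesh_tendsto_0] always_eventually) auto
    then have "(\<lambda>n. ?D n s \<omega>) \<longlonglongrightarrow> C s \<omega>" by (rule LIM_zero_cancel)
    then have "(\<lambda>n. ennreal (exp (- q * s) * ?D n s \<omega>)) \<longlonglongrightarrow> ennreal (exp (- q * s) * C s \<omega>)"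
      by (intro tendsto_ennrealI tendsto_mult_left)
    from Lim_transform_eventually[OF this ev]
    have "(\<lambda>n. payoff_density x (?D n) \<omega> s) \<longlonglongrightarrow> payoff_density x C \<omega> s"
      using True by (simp add: payoff_density_def)
    from lim_imp_Liminf[OF sequentially_bot this] show ?thesis by simp
  qed (auto simp: payoff_density_def)
  then have "payoff x C \<omega> \<le> (\<integral>\<^sup>+ s. liminf (\<lambda>n. payoff_density x (?D n) \<omega> s) \<partial>lborel)"
    unfolding payoff_def by (intro nn_integral_mono)
  also have "\<dots> \<le> liminf (\<lambda>n. payoff x (?D n) \<omega>)"
    unfolding payoff_def
    by (intro nn_integral_liminf payoff_density_measurable[OF round_strategy_admissible[OF C c] c(1) \<omega>])
  finally show ?thesis .
qed

text \<open>Fatou's lemma over the paths is applied to measurable versions \<open>h n\<close>, since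
  the payoffs are only known to agree almost everywhere with measurable functions.\<close>

lemma expected_payoff_le_liminf:
  assumes C: "C \<in> admissible M p T U cbar x c" and c: "0 \<le> c" "c \<le> cbar" and "0 \<le> x"
  shows "(\<integral>\<^sup>+ \<omega>. payoff x C \<omega> \<partial>completion M)
    \<le> liminf (\<lambda>n. \<integral>\<^sup>+ \<omega>. payoff x (round_strategy c C n) \<omega> \<partial>completion M)"
proof -
  let ?D = "round_strategy c C"
  have "\<exists>h. h \<in> borel_measurable (completion M) \<and> (AE \<omega> in completion M. payoff x (?D n) \<omega> = h \<omega>)" for n
    using payoff_AE_eq_measurable[OF round_strategy_admissible[OF C c, of n] c(1)] by blast
  then obtain h where h: "\<And>n. h n \<in> borel_measurable (completion M)"
    "\<And>n. AE \<omega> in completion M. payoff x (?D n) \<omega> = h n \<omega>" by metis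
  have "AE \<omega> in M. \<forall>i. ctrl_surplus p T U x C (arrival T i \<omega>) \<omega> \<noteq> 0"
    using AE_ctrl_surplus_arrival_nonzero[OF C c(1)] by (simp add: AE_all_countable)
  then have "AE \<omega> in M. payoff x C \<omega> \<le> liminf (\<lambda>n. payoff x (?D n) \<omega>)"
    using AE_regular_path AE_space
    by eventually_elim (rule payoff_le_liminf[OF C c \<open>0 \<le> x\<close>]; simp)
  then have "AE \<omega> in completion M. payoff x C \<omega> \<le> liminf (\<lambda>n. payoff x (?D n) \<omega>)" by (rule AE_completion)
  moreover have "AE \<omega> in completion M. \<forall>n. payoff x (?D n) \<omega> = h n \<omega>" using h(2) by (simp add: AE_all_countable)
  ultimately have "AE \<omega> in completion M. payoff x C \<omega> \<le> liminf (\<lambda>n. h n \<omega>)"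
    by eventually_elim simp
  then have "(\<integral>\<^sup>+ \<omega>. payoff x C \<omega> \<partial>completion M) \<le> (\<integral>\<^sup>+ \<omega>. liminf (\<lambda>n. h n \<omega>) \<partial>completion M)"
    by (rule nn_integral_mono_AE)
  also have "\<dots> \<le> liminf (\<lambda>n. \<integral>\<^sup>+ \<omega>. h n \<omega> \<partial>completion M)"
    by (rule nn_integral_liminf) (rule h(1))
  also have "(\<lambda>n. \<integral>\<^sup>+ \<omega>. h n \<omega> \<partial>completion M) = (\<lambda>n. \<integral>\<^sup>+ \<omega>. payoff x (?D n) \<omega> \<partial>completion M)"
    by (intro ext nn_integral_cong_AE) (use h(2) in \<open>simp add: eq_commute\<close>)
  finally show ?thesis .
qed

section \<open>Passage to the value functions\<close>

lemma Jval_le: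
  assumes "C \<in> admissible M p T U cbar x c"
  shows "Jval M p T U q x C \<le> cbar / q"
  unfolding Jval_eq using expected_payoff_le[OF assms] cbar_pos discount_pos
  by (intro enn2real_leI) auto

lemma Jval_bdd_above: "bdd_above (Jval M p T U q x ` admissible M p T U cbar x c)"
  by (intro bdd_aboveI2[of _ _ "cbar / q"] Jval_le)

text \<open>Makes the suprema range over nonempty sets. The convention is met because a constant
  equals its left limits.\<close>

lemma constant_admissible:
  assumes c: "0 \<le> c" "c \<le> cbar"
  shows "(\<lambda>_ _. c) \<in> admissible M p T U cbar x c"
proof -
  have "Lim (at_left t) (\<lambda>_. c) = c" for t :: real by (rule tendsto_Lim) auto
  then show ?thesis using c unfolding admissible_def by (auto intro: mono_onI)
qed

text \<open>Grid strategies are among all strategies, which bounds from above. From below, a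
  strategy with value beyond \<open>a\<close> is rounded, and the Fatou estimate lifts the rounded
  values beyond \<open>a\<close> eventually.\<close>

lemma Vn_tendsto_Vopt:
  assumes "0 \<le> x" and c: "0 \<le> c" "c \<le> cbar"
  shows "(\<lambda>n. Vn M p T U q cbar n x c) \<longlonglongrightarrow> Vopt M p T U q cbar x c"
proof -
  let ?A = "admissible M p T U cbar x c"
  let ?G = "\<lambda>n. {C \<in> ?A. \<forall>t\<ge>0. \<forall>\<omega>\<in>space M. C t \<omega> \<in> grid p cbar n}"
  let ?J = "Jval M p T U q x"
  have G: "round_strategy c C n \<in> ?G n" if "C \<in> ?A" for C n
    using round_strategy_admissible[OF that c] round_strategy_bounds(1)[OF c] by blast
  have Jn: "?J D \<le> Vn M p T U q cbar n x c" if "D \<in> ?G n" for D n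
    unfolding Vn_def VG_def
    by (rule cSUP_upper[OF that]) (rule bdd_above_mono[OF Jval_bdd_above], blast)
  have upper: "Vn M p T U q cbar n x c \<le> Vopt M p T U q cbar x c" for n
    unfolding Vn_def VG_def Vopt_def
  proof (rule cSUP_subset_mono)
    show "?G n \<noteq> {}" using G[OF constant_admissible[OF c]] by blast
  qed (use Jval_bdd_above in auto)
  show ?thesis
  proof (rule order_tendstoI)
    fix a assume a: "Vopt M p T U q cbar x c < a"
    show "eventually (\<lambda>n. Vn M p T U q cbar n x c < a) sequentially"
      by (intro always_eventually allI le_less_trans[OF upper a])
  next
    fix a assume "a < Vopt M p T U q cbar x c"
    then obtain C where C: "C \<in> ?A" "a < ?J C"
      unfolding Vopt_def using less_cSUP_iff[OF _ Jval_bdd_above] constant_admissible[OF c] by blast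
    let ?E = "\<lambda>D. \<integral>\<^sup>+ \<omega>. payoff x D \<omega> \<partial>completion M"
    \<comment> \<open>Expected payoffs are bounded by \<open>cbar / q\<close>, so
      \<open>enn2real\<close> hides no infinite value.\<close>
    have fin: "?E D = ennreal (?J D)" if "D \<in> ?A" for D
      unfolding Jval_eq using expected_payoff_le[OF that] by (intro ennreal_enn2real[symmetric]) (auto simp: top.extremum_strict intro: le_less_trans)
    \<comment> \<open>Passing to \<open>ennreal\<close> is faithful only for nonnegative
      \<open>a\<close>, since negative numbers are truncated to 0; for negative \<open>a\<close>,
      nonnegative payoffs suffice.\<close>
    show "eventually (\<lambda>n. a < Vn M p T U q cbar n x c) sequentially"
    proof (cases "0 \<le> a")
      case True
      have "ennreal a < ?E C" using C True by (simp add: fin ennreal_lessI)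
      also have "\<dots> \<le> liminf (\<lambda>n. ?E (round_strategy c C n))"
        by (rule expected_payoff_le_liminf[OF C(1) c \<open>0 \<le> x\<close>])
      finally have "eventually (\<lambda>n. ennreal a < ?E (round_strategy c C n)) sequentially"
        by (rule less_LiminfD)
      then show ?thesis
      proof eventually_elim
        case (elim n)
        then have "a < ?J (round_strategy c C n)"
          using True G[OF C(1), of n] by (simp add: fin ennreal_less_iff)
        also have "\<dots> \<le> Vn M p T U q cbar n x c" by (rule Jn[OF G[OF C(1)]])
        finally show ?case .
      qed
    next
      case False
      have "a < Vn M p T U q cbar n x c" for n
      proof -
        have "a < 0" using False by simp
        also have "0 \<le> ?J (round_strategy c C n)" by (simp add: Jval_eq)
        also have "\<dots> \<le> Vn M p T U q cbar n x c" by (rule Jn[OF G[OF C(1)]])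
        finally show ?thesis .
      qed
      then show ?thesis by simp
    qed
  qed
qed

end

theorem theorem6p5:
  fixes M :: "'a measure" and T U :: "nat \<Rightarrow> 'a \<Rightarrow> real" and F :: "real \<Rightarrow> real"
    and p \<beta> q cbar K x c :: real
  assumes "prob_space M"
    and "p > 0" and "\<beta> > 0" and "q > 0" and "cbar > 0"
    and "\<And>i. distributed M lborel (T i) (exponential_density \<beta>)"
    and "\<And>i. U i \<in> borel_measurable M"
    and "\<And>i u. measure M {\<omega> \<in> space M. U i \<omega> \<le> u} = F u"
    and "F 0 = 0"
    and "prob_space.indep_vars M (\<lambda>_. borel) (\<lambda>k. case k of Inl i \<Rightarrow> T i | Inr i \<Rightarrow> U i) UNIV"
    and "K > 0" and "\<And>u v. \<bar>F u - F v\<bar> \<le> K * \<bar>u - v\<bar>"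
    and "integrable M (U 0)"
    and "p > \<beta> * integral\<^sup>L M (U 0)"
    and "x \<ge> 0" and "0 \<le> c" and "c \<le> cbar"
  shows "(\<lambda>n. Vn M p T U q cbar n x c) \<longlonglongrightarrow> Vopt M p T U q cbar x c"
proof -
  interpret prob_space M by fact
  interpret cramer_lundberg M T U F p \<beta> q cbar K
    by unfold_locales (fact assms)+
  show ?thesis using assms(15-17) by (rule Vn_tendsto_Vopt)
qed

end
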